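(* Let $H$ be a finite connected simple bipartite graph of maximum degree at most $3$, minimum degree $2$, and girth $4$. If $H$ has no adjacency eigenvalue in $(-1,1)$, then $H$ is isomorphic to $\mathsf{HJ}_1^+$, $\mathsf{HJ}_2^+$, or $\mathsf{HJ}_n$ for some $n\ge1$.
   Context: The twisted ladder $T_n$ ($n\ge1$) has vertices $x_i, x_i', y_i, y_i'$ ($1\le i\le n$) and edges $x_iy_i, x_iy_i', x_i'y_i, x_i'y_i'$ for $1\le i\le n$ and $y_ix_{i+1}, y_i'x_{i+1}'$ for $1\le i\le n-1$. $\mathsf{HJ}_n$ is obtained from $T_n$ by adding six new vertices $p,q,r,s,t,u$ and edges $x_1p, pq, qr, rx_1', y_ns, st, tu, uy_n'$. $\mathsf{HJ}_1^+$ (resp. $\mathsf{HJ}_2^+$) is obtained from $\mathsf{HJ}_1$ (resp. $\mathsf{HJ}_2$) by adding the edge $qt$. *)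

theory Defs
  imports
    "Graph_Theory.Graph_Theory"
    "Jordan_Normal_Form.Char_Poly"
    "HOL-Library.Extended_Nat"
begin

text \<open>A finite simple undirected graph is a \<^locale>\<open>pair_graph\<close>: a finite, loop-free, symmetric
  digraph whose arcs are pairs of vertices, each undirected edge being represented by the two
  opposite arcs.\<close>

subsection \<open>Graph parameters\<close>

text \<open>In a symmetric digraph the out-degree of a vertex is its degree in the undirected graph.\<close>

definition max_degree :: "'a pair_pre_digraph \<Rightarrow> nat" where
  "max_degree G = Max (out_degree (with_proj G) ` pverts G)"

definition min_degree :: "'a pair_pre_digraph \<Rightarrow> nat" where
  "min_degree G = Min (out_degree (with_proj G) ` pverts G)"

definition bipartite :: "'a pair_pre_digraph \<Rightarrow> bool" where
  "bipartite G \<longleftrightarrow> (\<exists>A B. pverts G = A \<union> B \<and> A \<inter> B = {} \<and>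
     (\<forall>(u, v) \<in> parcs G. (u \<in> A \<and> v \<in> B) \<or> (u \<in> B \<and> v \<in> A)))"

text \<open>\<^const>\<open>pre_digraph.cycle\<close> also accepts the walk from \<open>u\<close> to \<open>v\<close> and back along one
  undirected edge; requiring length at least 3 leaves exactly the cycles of the undirected graph.
  The girth of a forest is \<open>\<infinity>\<close>.\<close>

definition girth :: "'a pair_pre_digraph \<Rightarrow> enat" where
  "girth G = Inf {enat (length p) |p. pre_digraph.cycle (with_proj G) p \<and> 3 \<le> length p}"

text \<open>The adjacency matrix with respect to an enumeration \<open>vs\<close> of the vertices. A different
  enumeration conjugates the matrix by a permutation matrix, so the eigenvalues do not depend on
  the choice. The matrix is real symmetric, so all its eigenvalues are real.\<close>

definition adjacency_matrix :: "'a pair_pre_digraph \<Rightarrow> 'a list \<Rightarrow> real mat" where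
  "adjacency_matrix G vs =
     mat (length vs) (length vs) (\<lambda>(i, j). if (vs ! i, vs ! j) \<in> parcs G then 1 else 0)"

definition adjacency_eigenvalue :: "'a pair_pre_digraph \<Rightarrow> real \<Rightarrow> bool" where
  "adjacency_eigenvalue G k \<longleftrightarrow>
     (\<exists>vs. distinct vs \<and> set vs = pverts G \<and> eigenvalue (adjacency_matrix G vs) k)"

abbreviation graph_iso :: "'a pair_pre_digraph \<Rightarrow> 'b pair_pre_digraph \<Rightarrow> bool" where
  "graph_iso G H \<equiv> digraph_iso (with_proj G) (with_proj H)"

subsection \<open>The twisted ladders and the graphs HJ\<close>

datatype hj_vertex =
    VX nat | VX' nat | VY nat | VY' nat | VP | VQ | VR | VS | VT | VU

definition ladder_verts :: "nat \<Rightarrow> hj_vertex set" where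
  "ladder_verts n = (\<Union>i \<in> {1..n}. {VX i, VX' i, VY i, VY' i})"

text \<open>The edge sets below list one orientation of each edge; the graphs use the symmetric closure
  \<^const>\<open>symcl\<close>.\<close>

definition ladder_edges :: "nat \<Rightarrow> hj_vertex rel" where
  "ladder_edges n =
     (\<Union>i \<in> {1..n}. {(VX i, VY i), (VX i, VY' i), (VX' i, VY i), (VX' i, VY' i)}) \<union>
     (\<Union>i \<in> {1..<n}. {(VY i, VX (i + 1)), (VY' i, VX' (i + 1))})"

definition twisted_ladder :: "nat \<Rightarrow> hj_vertex pair_pre_digraph" where
  "twisted_ladder n = \<lparr>pverts = ladder_verts n, parcs = symcl (ladder_edges n)\<rparr>"

definition HJ :: "nat \<Rightarrow> hj_vertex pair_pre_digraph" where
  "HJ n = \<lparr>pverts = pverts (twisted_ladder n) \<union> {VP, VQ, VR, VS, VT, VU},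
     parcs = parcs (twisted_ladder n) \<union>
       symcl {(VX 1, VP), (VP, VQ), (VQ, VR), (VR, VX' 1),
              (VY n, VS), (VS, VT), (VT, VU), (VU, VY' n)}\<rparr>"

definition HJ_plus :: "nat \<Rightarrow> hj_vertex pair_pre_digraph" where
  "HJ_plus n = \<lparr>pverts = pverts (HJ n), parcs = parcs (HJ n) \<union> symcl {(VQ, VT)}\<rparr>"

end

theory Submission
  imports Defs "HOL-Analysis.Function_Topology"
begin

text \<open>
  A graph has no eigenvalue in \<open>(-1, 1)\<close> iff \<open>A\<^sup>2 - I\<close> is positive
  semidefinite. Applied to \<open>e\<^sub>x - e\<^sub>x'\<close> for opposite vertices of a 4-cycle, this forces both
  to have degree 3, and the vector lies in the kernel. Hence \<open>A (e\<^sub>x - e\<^sub>x') = e\<^sub>a - e\<^sub>a'\<close> and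
  \<open>A (e\<^sub>a - e\<^sub>a') = e\<^sub>x - e\<^sub>x'\<close>, where \<open>a\<close> and \<open>a'\<close> are the third neighbours, so \<open>a\<close> and \<open>a'\<close> have
  the same other neighbours: either two of them, which gives the next 4-cycle of a twisted ladder,
  or a single one, which gives a cap. A maximal ladder does not close up on itself, because some
  vertex has degree 2, so it is capped at both ends, which gives an \<open>HJ\<close>. A third neighbour of the
  middle vertex of a cap is excluded by an explicit test vector, unless it joins the two
  caps of a short ladder.
\<close>

subsection \<open>The quadratic form of the squared adjacency operator\<close>

text \<open>Working with neighbourhoods lets the adjacency operator \<open>A\<close> (here
  \<open>adj\<close>) act on functions on vertices, with no enumeration of the vertex set.\<close>

locale finite_nbhd =
  fixes V :: "'a set" and N :: "'a \<Rightarrow> 'a set"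
  assumes finite_V [simp]: "finite V"
    and N_subset: "N v \<subseteq> V"
    and N_sym: "u \<in> N v \<Longrightarrow> v \<in> N u"
begin

definition adj :: "('a \<Rightarrow> real) \<Rightarrow> 'a \<Rightarrow> real" where
  "adj f v = (\<Sum>u\<in>N v. f u)"

lemma finite_N [simp]: "finite (N v)"
  by (rule finite_subset[OF N_subset finite_V])

lemma N_commute: "u \<in> N v \<longleftrightarrow> v \<in> N u"
  by (rule iffI; rule N_sym)

lemma adj_restrict: "adj f v = (\<Sum>u\<in>V. if u \<in> N v then f u else 0)"
proof -
  have "N v = {u\<in>V. u \<in> N v}" using N_subset by auto
  then show ?thesis unfolding adj_def by (subst sum.inter_filter[symmetric]) simp_all
qed

lemma adj_add: "adj (\<lambda>v. f v + g v) v = adj f v + adj g v"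
  by (simp add: adj_def sum.distrib)

lemma adj_scale: "adj (\<lambda>v. c * f v) v = c * adj f v"
  by (simp add: adj_def sum_distrib_left)

lemma adj_cong: "(\<And>v. v \<in> V \<Longrightarrow> f v = g v) \<Longrightarrow> adj f v = adj g v"
  unfolding adj_def using N_subset by (intro sum.cong) auto

section \<open>Self-adjointness and minimisers of the quadratic form\<close>

lemma adj_selfadjoint: "(\<Sum>v\<in>V. adj f v * g v) = (\<Sum>v\<in>V. f v * adj g v)"
proof -
  have "(\<Sum>v\<in>V. adj f v * g v) = (\<Sum>v\<in>V. \<Sum>u\<in>V. if u \<in> N v then f u * g v else 0)"
    unfolding adj_restrict sum_distrib_right by (intro sum.cong refl) auto
  also have "\<dots> = (\<Sum>u\<in>V. \<Sum>v\<in>V. if u \<in> N v then f u * g v else 0)"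
    by (rule sum.swap)
  also have "\<dots> = (\<Sum>u\<in>V. f u * adj g u)"
    unfolding adj_restrict sum_distrib_left
    by (intro sum.cong refl) (simp add: N_commute)
  finally show ?thesis .
qed

text \<open>The form of \<open>A\<^sup>2 - c\<close> is nonnegative by \<open>le\<close> and
  vanishes at \<open>f\<close>, so its first variation at \<open>f\<close> vanishes as well:
  otherwise a small step along the residual \<open>g\<close> would make it negative. It serves with
  \<open>c\<close> the minimum of the form of \<open>A\<^sup>2\<close> on the unit sphere, and with
  \<open>c = 1\<close>.\<close>

lemma min_form_kernel:
  assumes le: "\<And>g. c * (\<Sum>v\<in>V. (g v)\<^sup>2) \<le> (\<Sum>v\<in>V. (adj g v)\<^sup>2)"
    and eq: "(\<Sum>v\<in>V. (adj f v)\<^sup>2) = c * (\<Sum>v\<in>V. (f v)\<^sup>2)"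
    and v: "v \<in> V"
  shows "adj (adj f) v = c * f v"
proof -
  define g where "g v = adj (adj f) v - c * f v" for v
  define S where "S = (\<Sum>v\<in>V. (g v)\<^sup>2)"
  define R where "R = (\<Sum>v\<in>V. (adj g v)\<^sup>2) - c * S"
  have R: "0 \<le> R" using le[of g] by (simp add: R_def S_def)
  have cross: "(\<Sum>v\<in>V. adj f v * adj g v) - c * (\<Sum>v\<in>V. f v * g v) = S"
  proof -
    have "S = (\<Sum>v\<in>V. adj (adj f) v * g v - c * (f v * g v))"
      unfolding S_def by (intro sum.cong) (auto simp: g_def power2_eq_square algebra_simps)
    then show ?thesis
      by (simp add: sum_subtractf sum_distrib_left adj_selfadjoint)
  qed
  \<comment> \<open>This is the form at \<open>f + t * g\<close>: the constant term vanishes by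
    \<open>eq\<close>, and the linear coefficient is \<open>2 * S\<close> by
    \<open>cross\<close>.\<close>
  have pos: "0 \<le> 2 * t * S + t\<^sup>2 * R" for t
  proof -
    have 1: "(\<Sum>v\<in>V. (f v + t * g v)\<^sup>2)
        = (\<Sum>v\<in>V. (f v)\<^sup>2) + 2 * t * (\<Sum>v\<in>V. f v * g v) + t\<^sup>2 * S"
      unfolding S_def sum_distrib_left sum.distrib[symmetric]
      by (intro sum.cong) (auto simp: power2_eq_square algebra_simps)
    have 2: "(\<Sum>v\<in>V. (adj f v + t * adj g v)\<^sup>2)
        = (\<Sum>v\<in>V. (adj f v)\<^sup>2) + 2 * t * (\<Sum>v\<in>V. adj f v * adj g v)
          + t\<^sup>2 * (\<Sum>v\<in>V. (adj g v)\<^sup>2)"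
      unfolding sum_distrib_left sum.distrib[symmetric]
      by (intro sum.cong) (auto simp: power2_eq_square algebra_simps)
    have "c * (\<Sum>v\<in>V. (f v + t * g v)\<^sup>2) \<le> (\<Sum>v\<in>V. (adj f v + t * adj g v)\<^sup>2)"
      using le[of "\<lambda>v. f v + t * g v"] by (simp add: adj_add adj_scale)
    then show ?thesis
      unfolding 1 2 cross[symmetric] R_def using eq by (simp add: algebra_simps)
  qed
  have "S = 0"
  proof (rule ccontr)
    assume "S \<noteq> 0"
    then have S: "0 < S" by (simp add: S_def order_less_le sum_nonneg)
    \<comment> \<open>The parabola has its minimum at \<open>- S / R\<close>; the denominator
      \<open>R + 1\<close> also covers \<open>R = 0\<close> and still gives a negative
      value.\<close>
    define t where "t = - (S / (R + 1))"
    have "2 * t * S + t\<^sup>2 * R = - (S / (R + 1))\<^sup>2 * (R + 2)"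
    proof -
      have "R + 1 \<noteq> 0" using R by simp
      then have "S = (S / (R + 1)) * (R + 1)" by simp
      then obtain q where q: "S = q * (R + 1)" "q = S / (R + 1)" by blast
      show ?thesis unfolding t_def q(2)[symmetric] by (subst q(1)) (simp add: algebra_simps power2_eq_square)
    qed
    moreover have "\<dots> < 0" using S R by simp
    ultimately show False using pos[of t] by linarith
  qed
  then have "g v = 0"
    using v by (simp add: S_def sum_nonneg_eq_0_iff)
  then show ?thesis by (simp add: g_def)
qed

text \<open>The squared norm of \<open>A f\<close> attains a minimum \<open>c\<close> on the unit
  sphere. If \<open>c < 1\<close>, a minimiser \<open>f0\<close> satisfies
  \<open>A\<^sup>2 f0 = c f0\<close>, and the factorisation \<open>(A - k) (A + k)\<close> with
  \<open>k = sqrt c\<close> yields an eigenvector for \<open>k\<close> or for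
  \<open>- k\<close>.\<close>

lemma no_small_eigenvalue_imp_form_ge:
  assumes noev: "\<And>k f v. \<lbrakk>\<bar>k\<bar> < 1; \<And>v. v \<in> V \<Longrightarrow> adj f v = k * f v; v \<in> V\<rbrakk> \<Longrightarrow> f v = 0"
  shows "(\<Sum>v\<in>V. (f v)\<^sup>2) \<le> (\<Sum>v\<in>V. (adj f v)\<^sup>2)"
proof (cases "V = {}")
  case False
  have contQ: "continuous_on UNIV (\<lambda>f. \<Sum>v\<in>V. (adj f v)\<^sup>2)"
    unfolding adj_def by (intro continuous_intros continuous_on_product_coordinates)
  have contS: "continuous_on UNIV (\<lambda>f::'a \<Rightarrow> real. \<Sum>v\<in>V. (f v)\<^sup>2)"
    by (intro continuous_intros continuous_on_product_coordinates)
  \<comment> \<open>Functions are defined on the whole type, so coordinates outside \<open>V\<close>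
    are pinned to 0. The box is then a product of compact sets, and \<open>K\<close> is the unit
    sphere inside it.\<close>
  define K where "K = {f \<in> PiE UNIV (\<lambda>v. if v \<in> V then {-1..1::real} else {0}). (\<Sum>v\<in>V. (f v)\<^sup>2) = 1}"
  have "compactin (product_topology (\<lambda>_. euclidean) UNIV) (PiE UNIV (\<lambda>v. if v \<in> V then {-1..1::real} else {0}))"
    by (subst compactin_PiE) auto
  then have "compact (PiE UNIV (\<lambda>v. if v \<in> V then {-1..1::real} else {0}))"
    by (simp add: euclidean_product_topology)
  moreover have "closed {f. (\<Sum>v\<in>V. (f v)\<^sup>2) = (1::real)}"
    by (intro closed_Collect_eq contS continuous_on_const)
  ultimately have "compact K"
    unfolding K_def Collect_conj_eq by (auto intro: compact_Int_closed)
  obtain w where w: "w \<in> V" using False by auto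
  have "(\<Sum>v\<in>V. (if v = w then 1 else 0)\<^sup>2) = (1::real)"
    using w by (simp add: if_distrib[of "\<lambda>x. x\<^sup>2"] cong: if_cong)
  then have "(\<lambda>v. if v = w then 1 else 0) \<in> K"
    using w by (auto simp: K_def)
  then have "K \<noteq> {}" by auto
  then obtain f0 where f0: "f0 \<in> K"
      and f0_min: "\<And>f. f \<in> K \<Longrightarrow> (\<Sum>v\<in>V. (adj f0 v)\<^sup>2) \<le> (\<Sum>v\<in>V. (adj f v)\<^sup>2)"
    using continuous_attains_inf[OF \<open>compact K\<close> _ continuous_on_subset[OF contQ subset_UNIV]] by metis
  define c where "c = (\<Sum>v\<in>V. (adj f0 v)\<^sup>2)"
  have c0: "0 \<le> c" by (simp add: c_def sum_nonneg)
  have min: "c * (\<Sum>v\<in>V. (f v)\<^sup>2) \<le> (\<Sum>v\<in>V. (adj f v)\<^sup>2)" for f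
  proof (cases "(\<Sum>v\<in>V. (f v)\<^sup>2) = 0")
    case False
    define s where "s = (\<Sum>v\<in>V. (f v)\<^sup>2)"
    have s: "0 < s" using False by (simp add: s_def order_less_le sum_nonneg)
    define h where "h v = (if v \<in> V then f v / sqrt s else 0)" for v
    have hs: "(\<Sum>v\<in>V. (h v)\<^sup>2) = 1"
    proof -
      have "(\<Sum>v\<in>V. (h v)\<^sup>2) = (\<Sum>v\<in>V. (f v)\<^sup>2 / s)"
        using s by (intro sum.cong) (auto simp: h_def power_divide)
      also have "\<dots> = 1" using s by (simp add: sum_divide_distrib[symmetric] s_def[symmetric])
      finally show ?thesis .
    qed
    have "\<bar>h v\<bar> \<le> 1" if "v \<in> V" for v
    proof -
      have "(h v)\<^sup>2 \<le> (\<Sum>v\<in>V. (h v)\<^sup>2)" using that by (intro member_le_sum) auto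
      then show ?thesis using hs by (simp add: abs_square_le_1)
    qed
    then have "h v \<in> (if v \<in> V then {-1..1} else {0})" for v
      by (cases "v \<in> V") (force simp: abs_le_iff, simp add: h_def)
    then have "h \<in> K" using hs unfolding K_def PiE_UNIV_domain by blast
    then have "c \<le> (\<Sum>v\<in>V. (adj h v)\<^sup>2)" using f0_min by (simp add: c_def)
    also have "\<dots> = (\<Sum>v\<in>V. (adj f v)\<^sup>2 / s)"
    proof (intro sum.cong refl)
      fix v
      have "adj h v = adj (\<lambda>v. (1 / sqrt s) * f v) v"
        by (rule adj_cong) (simp add: h_def)
      also have "\<dots> = (1 / sqrt s) * adj f v" by (rule adj_scale)
      finally have "adj h v = (1 / sqrt s) * adj f v" .
      then show "(adj h v)\<^sup>2 = (adj f v)\<^sup>2 / s"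
        using s by (simp add: power_divide)
    qed
    also have "\<dots> = (\<Sum>v\<in>V. (adj f v)\<^sup>2) / s" by (simp add: sum_divide_distrib)
    finally show ?thesis using s by (simp add: s_def[symmetric] field_simps)
  qed (simp add: sum_nonneg)
  have "1 \<le> c"
  proof (rule ccontr)
    assume "\<not> 1 \<le> c"
    define k where "k = sqrt c"
    have k: "\<bar>k\<bar> < 1" "k * k = c" using \<open>\<not> 1 \<le> c\<close> c0 by (auto simp: k_def)
    have f0_norm: "(\<Sum>v\<in>V. (f0 v)\<^sup>2) = 1" using f0 by (simp add: K_def)
    have ker: "adj (adj f0) v = c * f0 v" if "v \<in> V" for v
      by (rule min_form_kernel[OF min]) (auto simp: that f0_norm c_def)
    have "adj (\<lambda>v. adj f0 v + k * f0 v) v = k * (adj f0 v + k * f0 v)" if "v \<in> V" for v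
      by (simp add: adj_add adj_scale ker[OF that] distrib_left mult.assoc[symmetric] k(2))
    then have *: "adj f0 v + k * f0 v = 0" if "v \<in> V" for v
      using noev[of k "\<lambda>v. adj f0 v + k * f0 v"] k that by blast
    have "f0 v = 0" if "v \<in> V" for v
    proof (rule noev[of "- k" f0])
      fix v assume "v \<in> V" then show "adj f0 v = - k * f0 v" using * by fastforce
    qed (use k that in auto)
    then show False using f0_norm by simp
  qed
  then have "1 * (\<Sum>v\<in>V. (f v)\<^sup>2) \<le> c * (\<Sum>v\<in>V. (f v)\<^sup>2)"
    by (intro mult_right_mono) (auto simp: sum_nonneg)
  then have "(\<Sum>v\<in>V. (f v)\<^sup>2) \<le> c * (\<Sum>v\<in>V. (f v)\<^sup>2)" by (simp only: mult_1)
  then show ?thesis using min[of f] by (rule order_trans)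
next
  case True
  then show ?thesis by simp
qed

end

subsection \<open>Local structure of subcubic graphs with a spectral gap\<close>

text \<open>The spectral gap enters as \<open>form_ge\<close>, bipartiteness as the absence of
  triangles, and connectedness as the absence of proper nonempty closed sets.
  \<open>not_cubic\<close> comes from the minimum degree 2 and keeps a ladder from closing up on
  itself.\<close>

locale subcubic_gap_graph = finite_nbhd +
  assumes form_ge: "(\<Sum>v\<in>V. (f v)\<^sup>2) \<le> (\<Sum>v\<in>V. (adj f v)\<^sup>2)"
    and card_N_le: "card (N v) \<le> 3"
    and card_N_ge: "v \<in> V \<Longrightarrow> 2 \<le> card (N v)"
    and triangle_free: "v \<in> N u \<Longrightarrow> N u \<inter> N v = {}"
    and connected: "W \<subseteq> V \<Longrightarrow> W \<noteq> {} \<Longrightarrow> (\<And>w. w \<in> W \<Longrightarrow> N w \<subseteq> W) \<Longrightarrow> W = V"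
    and not_cubic: "\<exists>v\<in>V. card (N v) \<noteq> 3"
begin

lemma N_irrefl [simp]: "v \<notin> N v"
  using triangle_free[of v v] by auto

lemma N_in_V: "u \<in> N v \<Longrightarrow> u \<in> V"
  using N_subset by blast

lemma N_nonempty_in_V: "u \<in> N v \<Longrightarrow> v \<in> V"
  by (rule N_in_V[OF N_sym])

section \<open>Test vectors built from indicator functions\<close>

lemma adj_diff: "adj (\<lambda>v. f v - g v) v = adj f v - adj g v"
  by (simp add: adj_def sum_subtractf)

lemma adj_of_bool: "adj (\<lambda>x. of_bool (x = u)) v = of_bool (v \<in> N u)"
proof -
  have "adj (\<lambda>x. of_bool (x = u)) v = of_bool (u \<in> N v)"
    unfolding adj_def of_bool_def by (subst sum.delta) auto
  then show ?thesis by (simp add: N_commute)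
qed

lemma sum_of_bool_V: "S \<subseteq> V \<Longrightarrow> (\<Sum>v\<in>V. of_bool (v \<in> S)) = real (card S)"
  unfolding of_bool_def by (subst sum.inter_filter[symmetric]) (auto intro!: arg_cong[where f=card])

text \<open>The image of \<open>f = e_u - e_v\<close> is \<open>e_a - e_b\<close>. Both have squared
  norm 2, so \<open>form_ge\<close> is an equality at \<open>f\<close>, and
  \<open>min_form_kernel\<close> gives \<open>A (e_a - e_b) = e_u - e_v\<close>, which is read off
  vertex by vertex.\<close>

lemma twins:
  assumes "u \<in> V" "v \<in> V" and a: "N u - N v = {a}" and b: "N v - N u = {b}"
  shows "N a - N b = {u}" "N b - N a = {v}"
proof -
  define f where "f x = of_bool (x = u) - (of_bool (x = v) :: real)" for x
  have uv: "u \<noteq> v" using a by auto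
  have V: "a \<in> V" "b \<in> V" using a b N_subset by blast+
  have ab: "a \<noteq> b" using a b by auto
  have adjf: "adj f w = of_bool (w = a) - of_bool (w = b)" for w
  proof -
    have "adj f w = of_bool (w \<in> N u) - of_bool (w \<in> N v)"
      unfolding f_def[abs_def] by (simp add: adj_diff adj_of_bool)
    then show ?thesis using a b by (auto simp: of_bool_def)
  qed
  have c: "card {u, v} = 2" "card {a, b} = 2" using uv ab by auto
  have 1: "(f w)\<^sup>2 = of_bool (w \<in> {u, v})" "(adj f w)\<^sup>2 = of_bool (w \<in> {a, b})" for w
    using uv ab by (auto simp: f_def adjf)
  have "adj (adj f) w = f w" if "w \<in> V" for w
  proof -
    have "adj (adj f) w = 1 * f w"
      by (rule min_form_kernel)
         (use form_ge assms(1,2) uv ab V that in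
           \<open>simp_all add: 1 c sum_of_bool_V del: insert_iff of_bool_eq_0_iff\<close>)
    then show ?thesis by simp
  qed
  then have *: "of_bool (w \<in> N a) - of_bool (w \<in> N b) = f w" if "w \<in> V" for w
    using that unfolding adjf[abs_def] by (simp add: adj_diff adj_of_bool)
  have "w \<in> N a - N b \<longleftrightarrow> w = u" if "w \<in> V" for w
    using *[OF that] uv by (auto simp: f_def of_bool_def split: if_splits)
  then show "N a - N b = {u}" using N_subset[of a] \<open>u \<in> V\<close> by blast
  have "w \<in> N b - N a \<longleftrightarrow> w = v" if "w \<in> V" for w
    using *[OF that] uv by (auto simp: f_def of_bool_def split: if_splits)
  then show "N b - N a = {v}" using N_subset[of b] \<open>v \<in> V\<close> by blast
qed

text \<open>The vector \<open>e_x - e_x'\<close> has squared norm 2, and its image has entries 1 and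
  -1 exactly on the symmetric difference \<open>S\<close> of the two neighbourhoods. So
  \<open>S\<close> has at least two elements, while degree at most 3 leaves at most one for each of
  \<open>x\<close> and \<open>x'\<close>. The last two conclusions are then
  \<open>twins\<close>.\<close>

lemma square_neighbours:
  assumes "x \<noteq> x'" "y \<noteq> y'" "{y, y'} \<subseteq> N x" "{y, y'} \<subseteq> N x'"
  obtains a a' where "N x = {y, y', a}" "N x' = {y, y', a'}" "a \<noteq> a'" "a \<notin> {y, y'}" "a' \<notin> {y, y'}"
    "N a - N a' = {x}" "N a' - N a = {x'}"
proof -
  have V: "x \<in> V" "x' \<in> V" using assms N_nonempty_in_V by blast+
  define f where "f w = of_bool (w = x) - (of_bool (w = x') :: real)" for w
  define S where "S = (N x - N x') \<union> (N x' - N x)"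
  have "adj f w = of_bool (w \<in> N x) - of_bool (w \<in> N x')" for w
    unfolding f_def[abs_def] by (simp add: adj_diff adj_of_bool)
  then have 1: "(f w)\<^sup>2 = of_bool (w \<in> {x, x'})" "(adj f w)\<^sup>2 = of_bool (w \<in> S)" for w
    using assms(1) by (auto simp: f_def S_def)
  have "S \<subseteq> V" using N_subset by (auto simp: S_def)
  have "2 \<le> card S"
    using form_ge[of f] V \<open>S \<subseteq> V\<close> assms(1) unfolding 1 by (subst (asm) (1 2) sum_of_bool_V) auto
  moreover have "card S = card (N x - N x') + card (N x' - N x)"
    unfolding S_def by (rule card_Un_disjoint) auto
  moreover have small: "card (N w - {y, y'}) \<le> 1" if "{y, y'} \<subseteq> N w" for w
    using card_N_le[of w] that assms(2) by (subst card_Diff_subset) auto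
  moreover have "card (N x - N x') \<le> card (N x - {y, y'})" "card (N x' - N x) \<le> card (N x' - {y, y'})"
    using assms(3,4) by (auto intro!: card_mono simp del: card_Diff_subset card_Diff_insert)
  ultimately have "card (N x - N x') = 1" "card (N x' - N x) = 1"
      "card (N x - {y, y'}) = 1" "card (N x' - {y, y'}) = 1"
    using small[OF assms(3)] small[OF assms(4)] by linarith+
  then obtain a a' b b' where a: "N x - N x' = {a}" "N x' - N x = {a'}"
      and b: "N x - {y, y'} = {b}" "N x' - {y, y'} = {b'}"
    by (metis card_1_singletonE)
  have "{a} \<subseteq> {b}" "{a'} \<subseteq> {b'}"
    unfolding a[symmetric] b[symmetric] using assms(3,4) by auto
  then have ab: "b = a" "b' = a'" by auto
  have N: "N x = {y, y', a}" "N x' = {y, y', a'}"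
    using b assms(3,4) unfolding ab by blast+
  have ne: "a \<noteq> a'" "a \<notin> {y, y'}" "a' \<notin> {y, y'}"
    using a b unfolding ab by blast+
  from N ne twins[OF V a] show ?thesis by (rule that)
qed

text \<open>The test vector is \<open>3 e\<^sub>p - 2 e\<^sub>y + e\<^sub>c - e\<^sub>z\<close>: its squared norm is 15, that of its image
  under \<open>A\<close> is at most 14.\<close>

lemma cap_obstruction:
  assumes p: "N p = {x, q}" and y: "N y = {x, x', x2}"
    and zc: "q \<in> N z" "x2 \<in> N c" "c \<noteq> z"
    and dist: "distinct [q, x, x', x2]"
    and c: "q \<notin> N c" "x \<notin> N c" "x' \<notin> N c" and z: "x \<notin> N z" "x' \<notin> N z" "x2 \<notin> N z"
  shows False
proof -
  have V: "p \<in> V" "y \<in> V" "z \<in> V" "c \<in> V"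
    by (rule N_nonempty_in_V; use p y zc in blast)+
  have ne: "p \<noteq> y" "p \<noteq> c" "p \<noteq> z" "y \<noteq> c" "y \<noteq> z"
    using p y c z dist by auto
  define f :: "'a \<Rightarrow> real" where
    "f w = 3 * of_bool (w = p) - 2 * of_bool (w = y) - (of_bool (w = z) - of_bool (w = c))" for w
  have adjf: "adj f w = 3 * of_bool (w \<in> N p) - 2 * of_bool (w \<in> N y)
      - (of_bool (w \<in> N z) - of_bool (w \<in> N c))" for w
    unfolding f_def[abs_def] by (simp add: adj_diff adj_of_bool adj_scale)
  have "(f w)\<^sup>2 = 9 * of_bool (w \<in> {p}) + 4 * of_bool (w \<in> {y}) + of_bool (w \<in> {z, c})" for w
    using ne zc(3) by (auto simp: f_def)
  then have "(\<Sum>v\<in>V. (f v)\<^sup>2) = 9 * real (card {p}) + 4 * real (card {y}) + real (card {z, c})"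
    using V by (simp only: sum.distrib sum_distrib_left[symmetric] sum_of_bool_V insert_subset
      empty_subsetI simp_thms)
  then have "(\<Sum>v\<in>V. (f v)\<^sup>2) = 15" using zc(3) by auto
  \<comment> \<open>The entries of the image are 3 - 1 at \<open>q\<close>, 3 - 2 at
    \<open>x\<close>, -2 at \<open>x'\<close> and -2 + 1 at \<open>x2\<close>. Elsewhere only
    \<open>z\<close> and \<open>c\<close> contribute, and a common neighbour of theirs
    cancels.\<close>
  have bound: "(adj f w)\<^sup>2 \<le> 4 * of_bool (w \<in> {q, x'}) + of_bool (w \<in> {x, x2})
      + (of_bool (w \<in> N z - {q}) + of_bool (w \<in> N c - {x2}))" for w
  proof (cases "w \<in> {q, x, x', x2}")
    case True
    then consider "w = q" | "w = x" | "w = x'" | "w = x2" by blast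
    then show ?thesis
      by cases (use p y zc dist c z in \<open>auto simp: adjf\<close>)
  next
    case False
    then show ?thesis unfolding adjf p y by (simp add: of_bool_def)
  qed
  have "(\<Sum>v\<in>V. (adj f v)\<^sup>2) \<le> (\<Sum>w\<in>V. 4 * of_bool (w \<in> {q, x'}) + of_bool (w \<in> {x, x2})
      + (of_bool (w \<in> N z - {q}) + of_bool (w \<in> N c - {x2})))"
    by (rule sum_mono) (rule bound)
  also have "\<dots> = 4 * real (card {q, x'}) + real (card {x, x2})
      + (real (card (N z - {q})) + real (card (N c - {x2})))"
  proof -
    have "{q, x'} \<subseteq> V" "{x, x2} \<subseteq> V" "N z - {q} \<subseteq> V" "N c - {x2} \<subseteq> V"
      using p y N_subset by blast+
    then show ?thesis
      by (simp only: sum.distrib sum_distrib_left[symmetric] sum_of_bool_V)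
  qed
  also have "\<dots> \<le> 14"
  proof -
    have "card (N z - {q}) \<le> 2" "card (N c - {x2}) \<le> 2"
      using card_N_le[of z] card_N_le[of c] zc by (simp_all add: card_Diff_singleton)
    then show ?thesis using dist by auto
  qed
  finally show False using form_ge[of f] \<open>(\<Sum>v\<in>V. (f v)\<^sup>2) = 15\<close> by simp
qed

end

subsection \<open>Neighbourhoods and symmetries of the ladders\<close>

definition nbhd :: "'b pair_pre_digraph \<Rightarrow> 'b \<Rightarrow> 'b set" where
  "nbhd G v = {w. (v, w) \<in> parcs G}"

lemma mem_symcl: "(a, b) \<in> symcl R \<longleftrightarrow> (a, b) \<in> R \<or> (b, a) \<in> R"
  by (auto simp: symcl_def)

lemma ladder_edges_iff:
  "(VX i, b) \<in> ladder_edges n \<longleftrightarrow> 1 \<le> i \<and> i \<le> n \<and> (b = VY i \<or> b = VY' i)"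
  "(VX' i, b) \<in> ladder_edges n \<longleftrightarrow> 1 \<le> i \<and> i \<le> n \<and> (b = VY i \<or> b = VY' i)"
  "(VY i, b) \<in> ladder_edges n \<longleftrightarrow> 1 \<le> i \<and> i < n \<and> b = VX (Suc i)"
  "(VY' i, b) \<in> ladder_edges n \<longleftrightarrow> 1 \<le> i \<and> i < n \<and> b = VX' (Suc i)"
  "(a, VX i) \<in> ladder_edges n \<longleftrightarrow> 1 < i \<and> i \<le> n \<and> a = VY (i - 1)"
  "(a, VX' i) \<in> ladder_edges n \<longleftrightarrow> 1 < i \<and> i \<le> n \<and> a = VY' (i - 1)"
  "(a, VY i) \<in> ladder_edges n \<longleftrightarrow> 1 \<le> i \<and> i \<le> n \<and> (a = VX i \<or> a = VX' i)"
  "(a, VY' i) \<in> ladder_edges n \<longleftrightarrow> 1 \<le> i \<and> i \<le> n \<and> (a = VX i \<or> a = VX' i)"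
  "a \<in> {VP, VQ, VR, VS, VT, VU} \<Longrightarrow> (a, b) \<notin> ladder_edges n"
  "a \<in> {VP, VQ, VR, VS, VT, VU} \<Longrightarrow> (b, a) \<notin> ladder_edges n"
  by (auto simp: ladder_edges_def)

lemma ladder_verts_iff [simp]:
  "VX i \<in> ladder_verts n \<longleftrightarrow> 1 \<le> i \<and> i \<le> n" "VX' i \<in> ladder_verts n \<longleftrightarrow> 1 \<le> i \<and> i \<le> n"
  "VY i \<in> ladder_verts n \<longleftrightarrow> 1 \<le> i \<and> i \<le> n" "VY' i \<in> ladder_verts n \<longleftrightarrow> 1 \<le> i \<and> i \<le> n"
  "VP \<notin> ladder_verts n" "VQ \<notin> ladder_verts n" "VR \<notin> ladder_verts n"
  "VS \<notin> ladder_verts n" "VT \<notin> ladder_verts n" "VU \<notin> ladder_verts n"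
  by (auto simp: ladder_verts_def)

lemma pverts_simps [simp]:
  "pverts (twisted_ladder n) = ladder_verts n"
  "pverts (HJ n) = ladder_verts n \<union> {VP, VQ, VR, VS, VT, VU}"
  "pverts (HJ_plus n) = pverts (HJ n)"
  by (simp_all add: twisted_ladder_def HJ_def HJ_plus_def)

lemma nbhd_ladder:
  "1 \<le> i \<Longrightarrow> i \<le> n \<Longrightarrow> nbhd (twisted_ladder n) (VX i) = {VY i, VY' i} \<union> (if i = 1 then {} else {VY (i - 1)})"
  "1 \<le> i \<Longrightarrow> i \<le> n \<Longrightarrow> nbhd (twisted_ladder n) (VX' i) = {VY i, VY' i} \<union> (if i = 1 then {} else {VY' (i - 1)})"
  "1 \<le> i \<Longrightarrow> i \<le> n \<Longrightarrow> nbhd (twisted_ladder n) (VY i) = {VX i, VX' i} \<union> (if i = n then {} else {VX (Suc i)})"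
  "1 \<le> i \<Longrightarrow> i \<le> n \<Longrightarrow> nbhd (twisted_ladder n) (VY' i) = {VX i, VX' i} \<union> (if i = n then {} else {VX' (Suc i)})"
  by (auto simp: nbhd_def twisted_ladder_def mem_symcl ladder_edges_iff)

lemma nbhd_HJ:
  "1 \<le> i \<Longrightarrow> i \<le> n \<Longrightarrow> nbhd (HJ n) (VX i) = {VY i, VY' i, if i = 1 then VP else VY (i - 1)}"
  "1 \<le> i \<Longrightarrow> i \<le> n \<Longrightarrow> nbhd (HJ n) (VX' i) = {VY i, VY' i, if i = 1 then VR else VY' (i - 1)}"
  "1 \<le> i \<Longrightarrow> i \<le> n \<Longrightarrow> nbhd (HJ n) (VY i) = {VX i, VX' i, if i = n then VS else VX (Suc i)}"
  "1 \<le> i \<Longrightarrow> i \<le> n \<Longrightarrow> nbhd (HJ n) (VY' i) = {VX i, VX' i, if i = n then VU else VX' (Suc i)}"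
  "nbhd (HJ n) VP = {VX 1, VQ}" "nbhd (HJ n) VQ = {VP, VR}" "nbhd (HJ n) VR = {VX' 1, VQ}"
  "nbhd (HJ n) VS = {VY n, VT}" "nbhd (HJ n) VT = {VS, VU}" "nbhd (HJ n) VU = {VY' n, VT}"
  by (auto simp: nbhd_def HJ_def twisted_ladder_def mem_symcl ladder_edges_iff)

lemma nbhd_HJ_plus:
  "nbhd (HJ_plus n) a = nbhd (HJ n) a \<union> (if a = VQ then {VT} else if a = VT then {VQ} else {})"
  by (auto simp: nbhd_def HJ_plus_def mem_symcl)

lemma nbhd_sym:
  "b \<in> nbhd (twisted_ladder n) a \<longleftrightarrow> a \<in> nbhd (twisted_ladder n) b"
  "b \<in> nbhd (HJ n) a \<longleftrightarrow> a \<in> nbhd (HJ n) b"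
  by (auto simp: nbhd_def twisted_ladder_def HJ_def mem_symcl)

lemma nbhd_subset:
  "nbhd (twisted_ladder n) a \<subseteq> ladder_verts n"
  "1 \<le> n \<Longrightarrow> nbhd (HJ n) a \<subseteq> pverts (HJ n)"
  "1 \<le> n \<Longrightarrow> nbhd (HJ_plus n) a \<subseteq> pverts (HJ n)"
proof -
  show "nbhd (twisted_ladder n) a \<subseteq> ladder_verts n"
    by (cases a) (auto simp: nbhd_def twisted_ladder_def mem_symcl ladder_edges_iff)
  show *: "nbhd (HJ n) a \<subseteq> pverts (HJ n)" if "1 \<le> n"
    using that by (cases a) (auto simp: nbhd_def HJ_def twisted_ladder_def mem_symcl ladder_edges_iff)
  show "nbhd (HJ_plus n) a \<subseteq> pverts (HJ n)" if "1 \<le> n"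
    using *[OF that] by (auto simp: nbhd_HJ_plus)
qed

text \<open>Written as one symmetric closure, the arc sets allow an embedding to be checked on one
  orientation of each edge, see \<open>embeds_symclI\<close>.\<close>

lemma parcs_eq_symcl:
  "parcs (twisted_ladder n) = symcl (ladder_edges n)"
  "parcs (HJ n) = symcl (ladder_edges n \<union> {(VX 1, VP), (VP, VQ), (VQ, VR), (VR, VX' 1),
     (VY n, VS), (VS, VT), (VT, VU), (VU, VY' n)})"
  "parcs (HJ_plus n) = symcl (insert (VQ, VT) (ladder_edges n \<union>
     {(VX 1, VP), (VP, VQ), (VQ, VR), (VR, VX' 1), (VY n, VS), (VS, VT), (VT, VU), (VU, VY' n)}))"
  by (auto simp: twisted_ladder_def HJ_def HJ_plus_def symcl_def)

lemma ladder_edges_Suc: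
  "1 \<le> n \<Longrightarrow> ladder_edges (Suc n) = ladder_edges n \<union>
     {(VX (Suc n), VY (Suc n)), (VX (Suc n), VY' (Suc n)), (VX' (Suc n), VY (Suc n)), (VX' (Suc n), VY' (Suc n)),
      (VY n, VX (Suc n)), (VY' n, VX' (Suc n))}"
  by (auto simp: ladder_edges_def atLeastAtMostSuc_conv atLeastLessThanSuc)

lemma ladder_verts_Suc:
  "ladder_verts (Suc n) = ladder_verts n \<union> {VX (Suc n), VX' (Suc n), VY (Suc n), VY' (Suc n)}"
  by (auto simp: ladder_verts_def atLeastAtMostSuc_conv)

lemma ladder_edges_in_verts: "(a, b) \<in> ladder_edges n \<Longrightarrow> a \<in> ladder_verts n \<and> b \<in> ladder_verts n"
  by (auto simp: ladder_edges_def)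

section \<open>Reversal of a ladder and exchange of primed and unprimed vertices\<close>

fun hj_rev :: "nat \<Rightarrow> hj_vertex \<Rightarrow> hj_vertex" where
  "hj_rev n (VX i) = VY (Suc n - i)"
| "hj_rev n (VX' i) = VY' (Suc n - i)"
| "hj_rev n (VY i) = VX (Suc n - i)"
| "hj_rev n (VY' i) = VX' (Suc n - i)"
| "hj_rev n VP = VS" | "hj_rev n VQ = VT" | "hj_rev n VR = VU"
| "hj_rev n VS = VP" | "hj_rev n VT = VQ" | "hj_rev n VU = VR"

fun hj_swap :: "hj_vertex \<Rightarrow> hj_vertex" where
  "hj_swap (VX i) = VX' i" | "hj_swap (VX' i) = VX i"
| "hj_swap (VY i) = VY' i" | "hj_swap (VY' i) = VY i"
| "hj_swap VP = VR" | "hj_swap VQ = VQ" | "hj_swap VR = VP"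
| "hj_swap VS = VU" | "hj_swap VT = VT" | "hj_swap VU = VS"

lemma involution_on_image:
  assumes "\<And>b. b \<in> A \<Longrightarrow> f b \<in> A" "\<And>b. b \<in> A \<Longrightarrow> f (f b) = b"
  shows "f ` A = A"
proof
  show "f ` A \<subseteq> A" using assms(1) by blast
  show "A \<subseteq> f ` A"
  proof
    fix b assume "b \<in> A"
    then have "b = f (f b)" "f b \<in> A" using assms by simp_all
    then show "b \<in> f ` A" by (rule image_eqI)
  qed
qed

lemma hj_rev_ladder_edges: "(a, b) \<in> ladder_edges n \<Longrightarrow> (hj_rev n b, hj_rev n a) \<in> ladder_edges n"
  by (cases a) (auto simp: ladder_edges_iff Suc_diff_Suc)

text \<open>Reversal exchanges the two ends and the two caps, so what is proved at
  \<open>VY n\<close> and at \<open>VQ\<close> carries over to \<open>VX 1\<close> and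
  \<open>VT\<close>. Because of truncated subtraction it is an involution on the vertices but not on
  all labels, hence \<open>inj_on\<close>.\<close>

lemma hj_rev_props:
  assumes "1 \<le> n"
  shows "inj_on (hj_rev n) (pverts (HJ n))" "hj_rev n ` ladder_verts n = ladder_verts n"
    "hj_rev n ` pverts (HJ n) = pverts (HJ n)"
    "hj_rev n ` nbhd (twisted_ladder n) a \<subseteq> nbhd (twisted_ladder n) (hj_rev n a)"
    "hj_rev n ` nbhd (HJ n) a \<subseteq> nbhd (HJ n) (hj_rev n a)"
proof -
  have inv: "hj_rev n (hj_rev n b) = b" if "b \<in> pverts (HJ n)" for b
    using that by (cases b) auto
  have ladder: "hj_rev n b \<in> ladder_verts n" if "b \<in> ladder_verts n" for b
    using that by (cases b) auto
  have hj: "hj_rev n b \<in> pverts (HJ n)" if "b \<in> pverts (HJ n)" for b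
    using that by (cases b) auto
  show "inj_on (hj_rev n) (pverts (HJ n))" by (rule inj_on_inverseI) (rule inv)
  show "hj_rev n ` ladder_verts n = ladder_verts n"
    by (rule involution_on_image, erule ladder, rule inv) simp
  show "hj_rev n ` pverts (HJ n) = pverts (HJ n)"
    by (rule involution_on_image[OF hj inv])
  have rev_ladder: "(hj_rev n a, hj_rev n b) \<in> parcs (twisted_ladder n)"
    if "(a, b) \<in> parcs (twisted_ladder n)" for b
    using that hj_rev_ladder_edges[of a b n] hj_rev_ladder_edges[of b a n]
    unfolding parcs_eq_symcl mem_symcl by blast
  show "hj_rev n ` nbhd (twisted_ladder n) a \<subseteq> nbhd (twisted_ladder n) (hj_rev n a)"
    using rev_ladder by (auto simp: nbhd_def)
  have "(hj_rev n a, hj_rev n b) \<in> parcs (HJ n)" if ab: "(a, b) \<in> parcs (HJ n)" for b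
  proof -
    have "(a, b) \<in> parcs (twisted_ladder n) \<or> (a, b) \<in> symcl {(VX 1, VP), (VP, VQ), (VQ, VR), (VR, VX' 1),
              (VY n, VS), (VS, VT), (VT, VU), (VU, VY' n)}"
      using ab by (simp add: HJ_def)
    then show ?thesis
    proof
      assume "(a, b) \<in> parcs (twisted_ladder n)"
      from rev_ladder[OF this] show ?thesis by (simp add: HJ_def)
    next
      assume "(a, b) \<in> symcl {(VX 1, VP), (VP, VQ), (VQ, VR), (VR, VX' 1),
              (VY n, VS), (VS, VT), (VT, VU), (VU, VY' n)}"
      then show ?thesis
        using assms unfolding mem_symcl insert_iff empty_iff Pair_inject
        by (elim disjE conjE FalseE) (simp_all add: HJ_def mem_symcl)
    qed
  qed
  then show "hj_rev n ` nbhd (HJ n) a \<subseteq> nbhd (HJ n) (hj_rev n a)"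
    by (auto simp: nbhd_def)
qed

text \<open>This carries what is proved at \<open>VY n\<close> over to \<open>VY' n\<close>.\<close>

lemma hj_swap_props:
  "inj hj_swap" "hj_swap ` ladder_verts n = ladder_verts n"
  "hj_swap ` nbhd (twisted_ladder n) a \<subseteq> nbhd (twisted_ladder n) (hj_swap a)"
proof -
  have inv: "hj_swap (hj_swap b) = b" for b by (cases b) auto
  have ladder: "hj_swap b \<in> ladder_verts n" if "b \<in> ladder_verts n" for b
    using that by (cases b) auto
  show "inj hj_swap" by (rule inj_on_inverseI) (rule inv)
  show "hj_swap ` ladder_verts n = ladder_verts n"
    by (rule involution_on_image[OF ladder inv])
  show "hj_swap ` nbhd (twisted_ladder n) a \<subseteq> nbhd (twisted_ladder n) (hj_swap a)"
    by (cases a) (auto simp: nbhd_def twisted_ladder_def mem_symcl ladder_edges_iff)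
qed

subsection \<open>Embedded ladders\<close>

context subcubic_gap_graph begin

text \<open>A copy as a subgraph, not as an induced one: further edges between the images are
  allowed. Degree bounds later turn the inclusion into an equality, vertex by vertex.\<close>

definition embeds :: "'b pair_pre_digraph \<Rightarrow> ('b \<Rightarrow> 'a) \<Rightarrow> bool" where
  "embeds G \<phi> \<longleftrightarrow> inj_on \<phi> (pverts G) \<and> (\<forall>a. \<phi> ` nbhd G a \<subseteq> N (\<phi> a))"

lemma embedsD:
  assumes "embeds G \<phi>"
  shows "inj_on \<phi> (pverts G)" "\<phi> ` nbhd G a \<subseteq> N (\<phi> a)"
  using assms by (simp_all add: embeds_def)

lemma embeds_nbhd_eq:
  assumes "embeds G \<phi>" "nbhd G a \<subseteq> pverts G" "card (N (\<phi> a)) \<le> card (nbhd G a)"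
  shows "N (\<phi> a) = \<phi> ` nbhd G a"
proof -
  have *: "inj_on \<phi> (nbhd G a)" "\<phi> ` nbhd G a \<subseteq> N (\<phi> a)"
    using embedsD[OF assms(1)] inj_on_subset[OF _ assms(2)] by metis+
  then have "card (N (\<phi> a)) \<le> card (\<phi> ` nbhd G a)"
    using assms(3) by (simp add: card_image)
  then show ?thesis
    using card_seteq[OF finite_N *(2)] by simp
qed

lemma embeds_symclI:
  assumes "parcs G = symcl E" "inj_on \<phi> (pverts G)" "\<And>a b. (a, b) \<in> E \<Longrightarrow> \<phi> b \<in> N (\<phi> a)"
  shows "embeds G \<phi>"
proof -
  have "\<phi> b \<in> N (\<phi> a)" if "(a, b) \<in> symcl E" for a b
    using that assms(3) N_sym[OF assms(3)] unfolding mem_symcl by blast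
  then show ?thesis using assms(1,2) by (auto simp: embeds_def nbhd_def)
qed

lemma embeds_comp:
  assumes "embeds G \<phi>" "inj_on \<sigma> (pverts G)" "\<sigma> ` pverts G \<subseteq> pverts G"
    and "\<And>a. \<sigma> ` nbhd G a \<subseteq> nbhd G (\<sigma> a)"
  shows "embeds G (\<phi> \<circ> \<sigma>)"
proof -
  have "inj_on (\<phi> \<circ> \<sigma>) (pverts G)"
    by (rule comp_inj_on[OF assms(2) inj_on_subset[OF embedsD(1)[OF assms(1)] assms(3)]])
  moreover have "\<phi> ` \<sigma> ` nbhd G a \<subseteq> N (\<phi> (\<sigma> a))" for a
    by (rule order_trans[OF image_mono[OF assms(4)] embedsD(2)[OF assms(1)]])
  ultimately show ?thesis by (simp add: embeds_def image_comp)
qed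

section \<open>Degrees in an embedded ladder\<close>

lemma ladder_square:
  assumes "embeds (twisted_ladder n) \<phi>" "1 \<le> i" "i \<le> n"
  shows "{\<phi> (VY i), \<phi> (VY' i)} \<subseteq> N (\<phi> (VX i))" "{\<phi> (VY i), \<phi> (VY' i)} \<subseteq> N (\<phi> (VX' i))"
    "{\<phi> (VX i), \<phi> (VX' i)} \<subseteq> N (\<phi> (VY i))" "{\<phi> (VX i), \<phi> (VX' i)} \<subseteq> N (\<phi> (VY' i))"
  using embedsD(2)[OF assms(1), of "VX i"] embedsD(2)[OF assms(1), of "VX' i"]
    embedsD(2)[OF assms(1), of "VY i"] embedsD(2)[OF assms(1), of "VY' i"] assms(2,3)
  by (simp_all add: nbhd_ladder)

lemma embeds_eq_iff:
  "embeds G \<phi> \<Longrightarrow> a \<in> pverts G \<Longrightarrow> b \<in> pverts G \<Longrightarrow> \<phi> a = \<phi> b \<longleftrightarrow> a = b"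
  by (rule inj_on_eq_iff[OF embedsD(1)])

lemma square_card:
  assumes "x \<noteq> x'" "y \<noteq> y'" "{y, y'} \<subseteq> N x" "{y, y'} \<subseteq> N x'"
  shows "card (N x) = 3" "card (N x') = 3"
  by (rule square_neighbours[OF assms]; use assms(2) in auto)+

text \<open>Each ladder vertex lies on one of the 4-cycles of the ladder, where
  \<open>square_card\<close> applies to it and its opposite vertex.\<close>

lemma ladder_card:
  assumes "embeds (twisted_ladder n) \<phi>" "a \<in> ladder_verts n"
  shows "card (N (\<phi> a)) = 3"
proof -
  obtain i where i: "1 \<le> i" "i \<le> n" "a \<in> {VX i, VX' i, VY i, VY' i}"
    using assms(2) by (auto simp: ladder_verts_def)
  have ne: "\<phi> (VX i) \<noteq> \<phi> (VX' i)" "\<phi> (VY i) \<noteq> \<phi> (VY' i)"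
    using i by (simp_all add: embeds_eq_iff[OF assms(1)])
  note sq = ladder_square[OF assms(1) i(1,2)]
  show ?thesis
    using square_card[OF ne sq(1,2)] square_card[OF ne(2,1) sq(3,4)] i(3) by auto
qed

text \<open>Away from the four end vertices the ladder itself supplies three neighbours, which
  exhausts the degree.\<close>

lemma ladder_inner:
  assumes "embeds (twisted_ladder n) \<phi>" "a \<in> ladder_verts n" "a \<notin> {VX 1, VX' 1, VY n, VY' n}"
  shows "N (\<phi> a) = \<phi> ` nbhd (twisted_ladder n) a"
proof (rule embeds_nbhd_eq[OF assms(1)])
  show "nbhd (twisted_ladder n) a \<subseteq> pverts (twisted_ladder n)" by (simp add: nbhd_subset)
  have "card (nbhd (twisted_ladder n) a) = 3"
    using assms(2,3) by (cases a) (auto simp: nbhd_ladder card_insert_if simp del: One_nat_def)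
  then show "card (N (\<phi> a)) \<le> card (nbhd (twisted_ladder n) a)"
    using ladder_card[OF assms(1,2)] by simp
qed

text \<open>A closed image would be all of \<open>V\<close> by connectedness, and then every degree
  would be 3, against \<open>not_cubic\<close>.\<close>

lemma ladder_not_closed:
  assumes "embeds (twisted_ladder n) \<phi>" "1 \<le> n"
  shows "\<exists>a\<in>ladder_verts n. \<not> N (\<phi> a) \<subseteq> \<phi> ` ladder_verts n"
proof (rule ccontr)
  assume closed: "\<not> ?thesis"
  define W where "W = \<phi> ` ladder_verts n"
  have V: "\<phi> a \<in> V" if "a \<in> ladder_verts n" for a
  proof -
    have "N (\<phi> a) \<noteq> {}" using ladder_card[OF assms(1) that] by auto
    then show ?thesis using N_nonempty_in_V by blast
  qed
  have "W = V"
  proof (rule connected)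
    show "W \<subseteq> V" using V by (auto simp: W_def)
    show "W \<noteq> {}" using assms(2) ladder_verts_iff(1)[of 1 n] unfolding W_def by blast
    show "N w \<subseteq> W" if "w \<in> W" for w using closed that by (auto simp: W_def)
  qed
  then show False using not_cubic ladder_card[OF assms(1)] by (auto simp: W_def)
qed

text \<open>If \<open>b\<close> were in the ladder, it would be an end vertex, as the others have no
  free edge, and irreflexivity and the absence of triangles leave x_1 or x_1'. The twin relation
  then forces \<open>b'\<close> to be the other of these two, so the ladder closes up, contradicting
  \<open>ladder_not_closed\<close>.\<close>

lemma ladder_end_fresh:
  assumes emb: "embeds (twisted_ladder n) \<phi>" and n: "1 \<le> n"
    and Y: "N (\<phi> (VY n)) = {\<phi> (VX n), \<phi> (VX' n), b}"
    and Y': "N (\<phi> (VY' n)) = {\<phi> (VX n), \<phi> (VX' n), b'}"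
    and b: "b \<notin> {\<phi> (VX n), \<phi> (VX' n)}" "b \<noteq> b'"
    and tw: "N b - N b' = {\<phi> (VY n)}" "N b' - N b = {\<phi> (VY' n)}"
  shows "b \<notin> \<phi> ` ladder_verts n"
proof
  let ?L = "twisted_ladder n"
  assume "b \<in> \<phi> ` ladder_verts n"
  then obtain a where a: "a \<in> ladder_verts n" "b = \<phi> a" by blast
  note eq = embeds_eq_iff[OF emb, simplified]
  have Yb: "\<phi> (VY n) \<in> N b" "\<phi> (VY' n) \<in> N b'" using tw by blast+
  have ends: "a \<in> {VX 1, VX' 1, VY n, VY' n}"
  proof (rule ccontr)
    assume inner: "a \<notin> {VX 1, VX' 1, VY n, VY' n}"
    have "\<phi> (VY n) \<in> \<phi> ` nbhd ?L a" using Yb ladder_inner[OF emb a(1) inner] a(2) by simp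
    then have "VY n \<in> nbhd ?L a"
      using inj_on_image_mem_iff[OF embedsD(1)[OF emb], of "VY n" "nbhd ?L a"] nbhd_subset(1) n
      by simp
    then have "a \<in> nbhd ?L (VY n)" by (simp only: nbhd_sym(1))
    then show False using b(1) a(2) n by (auto simp: nbhd_ladder)
  qed
  have "a \<noteq> VY n" using Yb(1) a(2) by auto
  moreover have "a \<noteq> VY' n"
  proof
    assume "a = VY' n"
    then have "\<phi> (VY' n) \<in> N (\<phi> (VY n))" using Y a(2) by simp
    from triangle_free[OF this] show False using Y Y' by auto
  qed
  ultimately have a1: "a = VX 1 \<or> a = VX' 1" using ends by blast
  \<comment> \<open>For \<open>n = 1\<close> the vertices x_1 and x_1' are x_n and x_n', which
    \<open>b\<close> avoids.\<close>
  then have n2: "2 \<le> n" using a(2) b(1) n by (cases "n = 1") auto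
  have sq: "{\<phi> (VY 1), \<phi> (VY' 1)} \<subseteq> N b"
    using a1 a(2) ladder_square(1,2)[OF emb order_refl n] by auto
  have Y1: "\<phi> (VY 1) \<noteq> \<phi> (VY n)" "\<phi> (VY' 1) \<noteq> \<phi> (VY n)" "\<phi> (VY 1) \<noteq> \<phi> (VY' 1)"
    using n2 by (simp_all add: eq)
  have "card (N b) = 3" using ladder_card[OF emb a(1)] a(2) by simp
  then have Nb: "N b = {\<phi> (VY 1), \<phi> (VY' 1), \<phi> (VY n)}"
    using sq Yb(1) Y1 by (intro card_seteq[symmetric]) auto
  have Nb': "{\<phi> (VY 1), \<phi> (VY' 1)} \<subseteq> N b'" using tw Nb Y1 by blast
  have inner1: "N (\<phi> (VY 1)) = {\<phi> (VX 1), \<phi> (VX' 1), \<phi> (VX 2)}"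
      "N (\<phi> (VY' 1)) = {\<phi> (VX 1), \<phi> (VX' 1), \<phi> (VX' 2)}"
    using n2 by (simp_all add: ladder_inner[OF emb] nbhd_ladder numeral_2_eq_2 insert_commute)
  have "b' \<in> {\<phi> (VX 1), \<phi> (VX' 1), \<phi> (VX 2)}" "b' \<in> {\<phi> (VX 1), \<phi> (VX' 1), \<phi> (VX' 2)}"
    using Nb' inner1 N_commute by blast+
  moreover have "\<phi> (VX 2) \<noteq> \<phi> (VX' 2)" using n2 by (simp add: eq)
  \<comment> \<open>The third neighbours x_2 and x_2' of y_1 and y_1' differ, so \<open>b'\<close>,
    a common neighbour of y_1 and y_1', is x_1 or x_1'.\<close>
  ultimately have b': "b' \<in> {\<phi> (VX 1), \<phi> (VX' 1)}" by blast
  have Nb'_eq: "N b' = {\<phi> (VY 1), \<phi> (VY' 1), \<phi> (VY' n)}"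
  proof (rule card_seteq[symmetric])
    have "card (N b') = 3" using b' n ladder_card[OF emb] by auto
    moreover have "\<phi> (VY 1) \<noteq> \<phi> (VY' n)" "\<phi> (VY' 1) \<noteq> \<phi> (VY' n)"
      using n2 by (simp_all add: eq)
    ultimately show "card (N b') \<le> card {\<phi> (VY 1), \<phi> (VY' 1), \<phi> (VY' n)}" using Y1 by auto
  qed (use Nb' Yb in auto)
  have bb: "{\<phi> (VX 1), \<phi> (VX' 1)} = {b, b'}" using a1 a(2) b' b(2) by auto
  \<comment> \<open>The remaining edges join y_n and y_n' to x_1 and x_1', straight or crossed; in
    both cases no edge leaves the ladder.\<close>
  have "N (\<phi> c) \<subseteq> \<phi> ` ladder_verts n" if "c \<in> ladder_verts n" for c
  proof (cases "c \<in> {VX 1, VX' 1, VY n, VY' n}")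
    case False
    then show ?thesis
      using ladder_inner[OF emb that] nbhd_subset(1) by (metis image_mono)
  next
    case True
    have "\<phi> ` {VX 1, VX' 1, VY 1, VY' 1, VX n, VX' n, VY n, VY' n} \<subseteq> \<phi> ` ladder_verts n"
      using n by (intro image_mono) auto
    moreover have "N (\<phi> c) \<subseteq> \<phi> ` {VX 1, VX' 1, VY 1, VY' 1, VX n, VX' n, VY n, VY' n}"
      using True bb Y Y' Nb Nb'_eq by auto
    ultimately show ?thesis by blast
  qed
  then show False using ladder_not_closed[OF emb n] by blast
qed

section \<open>The caps of a maximal ladder\<close>

lemma ladder_swap:
  assumes "embeds (twisted_ladder n) \<phi>"
  shows "embeds (twisted_ladder n) (\<phi> \<circ> hj_swap)"
  by (rule embeds_comp[OF assms])
    (simp_all add: hj_swap_props inj_on_subset[OF hj_swap_props(1)])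

lemma ladder_rev:
  assumes "embeds (twisted_ladder n) \<phi>" "1 \<le> n"
  shows "embeds (twisted_ladder n) (\<phi> \<circ> hj_rev n)"
  by (rule embeds_comp[OF assms(1)])
    (use hj_rev_props[OF assms(2)] in \<open>auto intro: inj_on_subset\<close>)

text \<open>By the twin relation the third neighbours \<open>b\<close>, \<open>b'\<close> of y_n,
  y_n' have the same set \<open>S\<close> of other neighbours. All of these vertices are new, and
  \<open>S\<close> has one or two elements. Two would give the next square of a longer ladder; a
  single one is the middle \<open>t\<close> of a cap with \<open>s = b\<close> and
  \<open>u = b'\<close>.\<close>

lemma maximal_ladder_cap:
  assumes emb: "embeds (twisted_ladder n) \<phi>" and n: "1 \<le> n"
    and max: "\<And>\<psi>. \<not> embeds (twisted_ladder (Suc n)) \<psi>"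
  obtains s t u where "N s = {\<phi> (VY n), t}" "N u = {\<phi> (VY' n), t}" "s \<noteq> u" "t \<noteq> s" "t \<noteq> u"
    "{s, t, u} \<inter> \<phi> ` ladder_verts n = {}"
proof -
  define W where "W = \<phi> ` ladder_verts n"
  note eq = embeds_eq_iff[OF emb, simplified]
  have ne: "\<phi> (VX n) \<noteq> \<phi> (VX' n)" "\<phi> (VY n) \<noteq> \<phi> (VY' n)" using n by (simp_all add: eq)
  obtain b b' where Y: "N (\<phi> (VY n)) = {\<phi> (VX n), \<phi> (VX' n), b}"
      and Y': "N (\<phi> (VY' n)) = {\<phi> (VX n), \<phi> (VX' n), b'}"
      and b: "b \<noteq> b'" "b \<notin> {\<phi> (VX n), \<phi> (VX' n)}" "b' \<notin> {\<phi> (VX n), \<phi> (VX' n)}"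
      and tw: "N b - N b' = {\<phi> (VY n)}" "N b' - N b = {\<phi> (VY' n)}"
    by (rule square_neighbours[OF ne(2,1) ladder_square(3,4)[OF emb n order_refl]])
  have bW: "b \<notin> W"
    unfolding W_def by (rule ladder_end_fresh[OF emb n Y Y' b(2,1) tw])
  \<comment> \<open>After the exchange of primed and unprimed vertices, \<open>b'\<close> is the
    third neighbour of the image of \<open>VY n\<close>.\<close>
  have "b' \<notin> (\<phi> \<circ> hj_swap) ` ladder_verts n"
    using ladder_end_fresh[OF ladder_swap[OF emb] n, of b' b] Y Y' b tw
    by (simp add: insert_commute)
  then have b'W: "b' \<notin> W"
    unfolding W_def image_comp[symmetric] hj_swap_props(2) .
  define S where "S = N b \<inter> N b'"
  have Nb: "N b = insert (\<phi> (VY n)) S" "N b' = insert (\<phi> (VY' n)) S"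
    using tw unfolding S_def by blast+
  have YS: "\<phi> (VY n) \<notin> S" "\<phi> (VY' n) \<notin> S" using tw unfolding S_def by blast+
  have finS: "finite S" by (simp add: S_def)
  have cardb: "card (N b) = Suc (card S)" using Nb YS finS by simp
  have SW: "S \<inter> W = {}"
  proof (rule ccontr)
    assume "S \<inter> W \<noteq> {}"
    then obtain a where a: "a \<in> ladder_verts n" "\<phi> a \<in> S" by (auto simp: W_def)
    then have bN: "b \<in> N (\<phi> a)" "b' \<in> N (\<phi> a)" using N_commute unfolding S_def by blast+
    have "a \<in> {VX 1, VX' 1, VY n, VY' n}"
    proof (rule ccontr)
      assume inner: "a \<notin> {VX 1, VX' 1, VY n, VY' n}"
      have "N (\<phi> a) \<subseteq> W"
        unfolding W_def ladder_inner[OF emb a(1) inner] by (intro image_mono nbhd_subset)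
      then show False using bN bW by blast
    qed
    then have "a = VX 1 \<or> a = VX' 1" using a(2) YS by auto
    then have "{\<phi> (VY 1), \<phi> (VY' 1)} \<subseteq> N (\<phi> a)"
      using ladder_square(1,2)[OF emb order_refl n] by blast
    \<comment> \<open>A ladder vertex in \<open>S\<close> can only be x_1 or x_1', and would then
      have four distinct neighbours.\<close>
    then have sub: "{\<phi> (VY 1), \<phi> (VY' 1), b, b'} \<subseteq> N (\<phi> a)" using bN by blast
    have "\<phi> (VY 1) \<in> W" "\<phi> (VY' 1) \<in> W" unfolding W_def using n by (auto intro!: imageI)
    moreover have "\<phi> (VY 1) \<noteq> \<phi> (VY' 1)" using n by (simp add: eq)
    ultimately have "distinct [\<phi> (VY 1), \<phi> (VY' 1), b, b']" using bW b'W b(1) by auto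
    from distinct_card[OF this] show False
      using card_mono[OF finite_N sub] card_N_le[of "\<phi> a"] by simp
  qed
  have "b \<in> V" using Y N_subset[of "\<phi> (VY n)"] by blast
  then have "card S = 1 \<or> card S = 2" using card_N_ge[of b] card_N_le[of b] cardb by auto
  then show thesis
  proof
    assume "card S = 1"
    then obtain t where t: "S = {t}" by (rule card_1_singletonE)
    have "t \<noteq> b" "t \<noteq> b'" using t unfolding S_def by auto
    then show thesis using that[of b t b'] Nb bW b'W SW b(1) unfolding t W_def by auto
  next
    assume "card S = 2"
    then obtain c c' where c: "S = {c, c'}" "c \<noteq> c'" by (auto simp: card_2_iff)
    have cc: "c \<in> N b" "c \<in> N b'" "c' \<in> N b" "c' \<in> N b'" using c unfolding S_def by blast+
    then have cb: "c \<noteq> b" "c \<noteq> b'" "c' \<noteq> b" "c' \<noteq> b'" by auto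
    define \<psi> where "\<psi> = \<phi>(VX (Suc n) := b, VX' (Suc n) := b', VY (Suc n) := c, VY' (Suc n) := c')"
    have old: "\<psi> a = \<phi> a" if "a \<in> ladder_verts n" for a
      using that by (auto simp: \<psi>_def)
    have img: "\<psi> ` ladder_verts n = W" using old by (auto simp: W_def)
    have new: "\<psi> (VX (Suc n)) = b" "\<psi> (VX' (Suc n)) = b'" "\<psi> (VY (Suc n)) = c" "\<psi> (VY' (Suc n)) = c'"
      by (simp_all add: \<psi>_def)
    have "inj_on \<psi> (ladder_verts n)"
      using embedsD(1)[OF emb] inj_on_cong[of "ladder_verts n" \<psi> \<phi>] old by simp
    then have inj: "inj_on \<psi> (ladder_verts (Suc n))"
      using bW b'W SW c cb b(1) unfolding ladder_verts_Suc by (simp add: new img)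
    have "embeds (twisted_ladder (Suc n)) \<psi>"
    proof (rule embeds_symclI[OF parcs_eq_symcl(1)])
      show "inj_on \<psi> (pverts (twisted_ladder (Suc n)))" using inj by simp
      fix x y assume "(x, y) \<in> ladder_edges (Suc n)"
      then consider "(x, y) \<in> ladder_edges n"
        | "x = VX (Suc n)" "y \<in> {VY (Suc n), VY' (Suc n)}" | "x = VX' (Suc n)" "y \<in> {VY (Suc n), VY' (Suc n)}"
        | "x = VY n" "y = VX (Suc n)" | "x = VY' n" "y = VX' (Suc n)"
        unfolding ladder_edges_Suc[OF n] by blast
      then show "\<psi> y \<in> N (\<psi> x)"
      proof cases
        case 1
        then have "\<phi> y \<in> N (\<phi> x)"
          using embedsD(2)[OF emb, of x] by (auto simp: nbhd_def parcs_eq_symcl mem_symcl)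
        then show ?thesis using ladder_edges_in_verts[OF 1] by (simp add: old)
      next
        case 2 then show ?thesis using cc by (auto simp: new)
      next
        case 3 then show ?thesis using cc by (auto simp: new)
      next
        case 4 then show ?thesis using Y n by (simp add: new old)
      next
        case 5 then show ?thesis using Y' n by (simp add: new old)
      qed
    qed
    then show thesis using max by blast
  qed
qed

text \<open>A 4-cycle is a ladder of length 1, and the distinct images of the \<open>VX i\<close>
  bound the length by \<open>card V\<close>, so a greatest length exists.\<close>

lemma exists_maximal_ladder:
  assumes "x \<noteq> x'" "y \<noteq> y'" "{y, y'} \<subseteq> N x" "{y, y'} \<subseteq> N x'"
  obtains n \<phi> where "1 \<le> n" "embeds (twisted_ladder n) \<phi>" "\<And>\<psi>. \<not> embeds (twisted_ladder (Suc n)) \<psi>"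
proof -
  define P where "P n \<longleftrightarrow> (\<exists>\<phi>. embeds (twisted_ladder n) \<phi>)" for n
  have P1: "P 1"
  proof -
    \<comment> \<open>The last branch is meant for \<open>VY' 1\<close>; on labels outside the
      ladder of length 1 it is a dummy value, since injectivity concerns the four vertices.\<close>
    define \<phi> where "\<phi> a = (if a = VX 1 then x else if a = VX' 1 then x' else if a = VY 1 then y else y')" for a
    have \<phi>: "\<phi> (VX 1) = x" "\<phi> (VX' 1) = x'" "\<phi> (VY 1) = y" "\<phi> (VY' 1) = y'"
      by (simp_all add: \<phi>_def)
    have "x \<noteq> y" "x \<noteq> y'" "x' \<noteq> y" "x' \<noteq> y'" using assms(3,4) by auto
    then have "inj_on \<phi> {VX 1, VX' 1, VY 1, VY' 1}"
      using assms(1,2) by (simp add: \<phi> del: One_nat_def)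
    then have "embeds (twisted_ladder 1) \<phi>"
      by (intro embeds_symclI[OF parcs_eq_symcl(1)])
        (use assms(3,4) in \<open>auto simp: ladder_verts_def ladder_edges_def \<phi>[unfolded One_nat_def]\<close>)
    then show ?thesis unfolding P_def by blast
  qed
  have bound: "n \<le> card V" if n: "P n" for n
  proof -
    obtain \<phi> where \<phi>: "embeds (twisted_ladder n) \<phi>" using n by (auto simp: P_def)
    have inj: "inj_on (\<lambda>i. \<phi> (VX i)) {1..n}"
      by (rule inj_onI) (simp add: embeds_eq_iff[OF \<phi>])
    have "(\<lambda>i. \<phi> (VX i)) ` {1..n} \<subseteq> V"
    proof (rule image_subsetI)
      fix i assume "i \<in> {1..n}"
      then have "\<phi> (VY i) \<in> N (\<phi> (VX i))" using ladder_square(1)[OF \<phi>, of i] by simp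
      then show "\<phi> (VX i) \<in> V" by (rule N_nonempty_in_V)
    qed
    from card_inj_on_le[OF inj this finite_V] show ?thesis by simp
  qed
  define n where "n = (GREATEST n. P n)"
  have "P n" unfolding n_def by (rule GreatestI_nat[of P, OF P1]) (use bound in blast)
  moreover have "1 \<le> n" unfolding n_def by (rule Greatest_le_nat[of P, OF P1]) (use bound in blast)
  moreover have "\<not> P (Suc n)"
  proof
    assume "P (Suc n)"
    then have "Suc n \<le> n" unfolding n_def by (rule Greatest_le_nat) (use bound in blast)
    then show False by simp
  qed
  ultimately show thesis using that unfolding P_def by blast
qed

text \<open>A maximal ladder is capped at one end directly and at the other end through its
  reversal. What needs an argument is that the two caps are disjoint.\<close>

lemma exists_HJ_embedding:
  assumes "x \<noteq> x'" "y \<noteq> y'" "{y, y'} \<subseteq> N x" "{y, y'} \<subseteq> N x'"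
  obtains n \<phi> where "1 \<le> n" "embeds (HJ n) \<phi>" "\<And>a. a \<in> {VP, VR, VS, VU} \<Longrightarrow> card (N (\<phi> a)) = 2"
proof -
  obtain n \<phi> where n: "1 \<le> n" and emb: "embeds (twisted_ladder n) \<phi>"
    and max: "\<And>\<psi>. \<not> embeds (twisted_ladder (Suc n)) \<psi>"
    using exists_maximal_ladder[OF assms] by blast
  define W where "W = \<phi> ` ladder_verts n"
  obtain s t u where s: "N s = {\<phi> (VY n), t}" and u: "N u = {\<phi> (VY' n), t}"
    and stu: "s \<noteq> u" "t \<noteq> s" "t \<noteq> u" "{s, t, u} \<inter> W = {}"
    unfolding W_def by (rule maximal_ladder_cap[OF emb n max])
  obtain p q r where "N p = {(\<phi> \<circ> hj_rev n) (VY n), q}" "N r = {(\<phi> \<circ> hj_rev n) (VY' n), q}"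
    "p \<noteq> r" "q \<noteq> p" "q \<noteq> r" "{p, q, r} \<inter> (\<phi> \<circ> hj_rev n) ` ladder_verts n = {}"
    by (rule maximal_ladder_cap[OF ladder_rev[OF emb n] n max])
  then have p: "N p = {\<phi> (VX 1), q}" and r: "N r = {\<phi> (VX' 1), q}"
    and pqr: "p \<noteq> r" "q \<noteq> p" "q \<noteq> r" "{p, q, r} \<inter> W = {}"
    unfolding image_comp[symmetric] hj_rev_props(2)[OF n] W_def by simp_all
  note eq = embeds_eq_iff[OF emb, simplified]
  have inW: "\<phi> (VX 1) \<in> W" "\<phi> (VX' 1) \<in> W" "\<phi> (VY n) \<in> W" "\<phi> (VY' n) \<in> W"
    unfolding W_def using n by (auto intro!: imageI)
  have neW: "\<phi> (VX 1) \<noteq> \<phi> (VY n)" "\<phi> (VX 1) \<noteq> \<phi> (VY' n)" "\<phi> (VX' 1) \<noteq> \<phi> (VY n)" "\<phi> (VX' 1) \<noteq> \<phi> (VY' n)"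
    "\<phi> (VX 1) \<noteq> \<phi> (VX' 1)" "\<phi> (VY n) \<noteq> \<phi> (VY' n)"
    using n by (simp_all add: eq)
  \<comment> \<open>Each of \<open>p\<close>, \<open>r\<close>, \<open>s\<close>, \<open>u\<close>
    has exactly one neighbour in the ladder, and it differs between the two caps.\<close>
  have ends: "p \<noteq> s" "p \<noteq> u" "r \<noteq> s" "r \<noteq> u"
    using p r s u neW inW stu(4) by (auto simp: doubleton_eq_iff)
  have Nq: "p \<in> N q" "r \<in> N q" and Nt: "s \<in> N t" "u \<in> N t"
    using p r s u by (simp_all add: N_commute[of _ q] N_commute[of _ t])
  \<comment> \<open>If \<open>t = p\<close>, then \<open>s\<close> and \<open>u\<close>, both
    neighbours of \<open>t\<close> outside the ladder, would both equal \<open>q\<close>. The other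
    three cases are alike.\<close>
  have "t \<noteq> p" "t \<noteq> r" using Nt p r stu inW by auto
  moreover have "q \<noteq> s" "q \<noteq> u" using Nq s u pqr inW by auto
  moreover have "q \<noteq> t"
  proof
    assume "q = t"
    then have sub: "{p, r, s, u} \<subseteq> N q" using Nq Nt by simp
    have "distinct [p, r, s, u]" using ends pqr stu by auto
    from distinct_card[OF this] show False using card_mono[OF finite_N sub] card_N_le[of q] by simp
  qed
  ultimately have dist: "distinct [p, q, r, s, t, u]" using ends pqr stu by auto
  define \<psi> where "\<psi> = \<phi>(VP := p, VQ := q, VR := r, VS := s, VT := t, VU := u)"
  have old: "\<psi> a = \<phi> a" if "a \<in> ladder_verts n" for a
    using that by (auto simp: \<psi>_def)
  have img: "\<psi> ` ladder_verts n = W" using old by (auto simp: W_def)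
  have new: "\<psi> VP = p" "\<psi> VQ = q" "\<psi> VR = r" "\<psi> VS = s" "\<psi> VT = t" "\<psi> VU = u"
    by (simp_all add: \<psi>_def)
  have "inj_on \<psi> (ladder_verts n)"
    using embedsD(1)[OF emb] inj_on_cong[of "ladder_verts n" \<psi> \<phi>] old by simp
  moreover have "inj_on \<psi> {VP, VQ, VR, VS, VT, VU}" using dist by (simp add: new)
  ultimately have inj: "inj_on \<psi> (pverts (HJ n))"
    using pqr(4) stu(4) unfolding pverts_simps by (subst inj_on_Un) (auto simp: img new)
  have "embeds (HJ n) \<psi>"
  proof (rule embeds_symclI[OF parcs_eq_symcl(2) inj])
    fix a b assume ab: "(a, b) \<in> ladder_edges n \<union> {(VX 1, VP), (VP, VQ), (VQ, VR), (VR, VX' 1),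
     (VY n, VS), (VS, VT), (VT, VU), (VU, VY' n)}"
    show "\<psi> b \<in> N (\<psi> a)"
    proof (cases "(a, b) \<in> ladder_edges n")
      case True
      then have "\<phi> b \<in> N (\<phi> a)"
        using embedsD(2)[OF emb, of a] by (auto simp: nbhd_def parcs_eq_symcl mem_symcl)
      then show ?thesis using ladder_edges_in_verts[OF True] by (simp add: old)
    next
      case False
      have "p \<in> N (\<phi> (VX 1))" "s \<in> N (\<phi> (VY n))"
        using p s by (simp_all add: N_commute[of p] N_commute[of s])
      moreover have "\<psi> (VX 1) = \<phi> (VX 1)" "\<psi> (VX' 1) = \<phi> (VX' 1)" "\<psi> (VY n) = \<phi> (VY n)" "\<psi> (VY' n) = \<phi> (VY' n)"
        using n by (simp_all add: old)
      ultimately show ?thesis using ab False p r s u Nq Nt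
        by (auto simp: new simp del: One_nat_def)
    qed
  qed
  moreover have "\<phi> (VX 1) \<noteq> q" "\<phi> (VX' 1) \<noteq> q" "\<phi> (VY n) \<noteq> t" "\<phi> (VY' n) \<noteq> t"
    using inW pqr(4) stu(4) by auto
  then have "card (N (\<psi> a)) = 2" if "a \<in> {VP, VR, VS, VU}" for a
    using that p r s u by (auto simp: new)
  ultimately show thesis using that[OF n, of \<psi>] by blast
qed

section \<open>The middle vertices of the caps\<close>

lemma HJ_rev:
  assumes "embeds (HJ n) \<phi>" "1 \<le> n"
  shows "embeds (HJ n) (\<phi> \<circ> hj_rev n)"
  by (rule embeds_comp[OF assms(1) hj_rev_props(1)[OF assms(2)]])
    (simp_all only: hj_rev_props[OF assms(2)] order_refl)

lemma HJ_inner: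
  assumes emb: "embeds (HJ n) \<phi>" and n: "1 \<le> n"
    and deg2: "\<And>a. a \<in> {VP, VR, VS, VU} \<Longrightarrow> card (N (\<phi> a)) = 2"
    and a: "a \<in> pverts (HJ n)" "a \<noteq> VQ" "a \<noteq> VT"
  shows "N (\<phi> a) = \<phi> ` nbhd (HJ n) a"
proof (rule embeds_nbhd_eq[OF emb nbhd_subset(2)[OF n]])
  show "card (N (\<phi> a)) \<le> card (nbhd (HJ n) a)"
  proof (cases "a \<in> ladder_verts n")
    case True
    then have "card (nbhd (HJ n) a) = 3"
      by (cases a) (auto simp: nbhd_HJ card_insert_if)
    then show ?thesis using card_N_le by simp
  next
    case False
    then have "a \<in> {VP, VR, VS, VU}" using a by auto
    then show ?thesis using deg2[of a] by (auto simp: nbhd_HJ)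
  qed
qed

text \<open>By \<open>HJ_inner\<close> every vertex of the copy except those labelled
  \<open>VQ\<close> and \<open>VT\<close> has no free edge, so \<open>z\<close> is the image of
  \<open>VT\<close> or lies outside the copy. If the claim failed, \<open>cap_obstruction\<close>
  would apply at y_1.\<close>

lemma HJ_cap_third_neighbour:
  assumes emb: "embeds (HJ n) \<phi>" and n: "1 \<le> n"
    and deg2: "\<And>a. a \<in> {VP, VR, VS, VU} \<Longrightarrow> card (N (\<phi> a)) = 2"
    and z: "z \<in> N (\<phi> VQ)" "z \<notin> {\<phi> VP, \<phi> VR}"
  shows "z = \<phi> VT" "n \<le> 2"
proof -
  note eq = embeds_eq_iff[OF emb]
  have inner: "N (\<phi> a) = \<phi> ` nbhd (HJ n) a" if "a \<in> pverts (HJ n)" "a \<noteq> VQ" "a \<noteq> VT" for a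
    by (rule HJ_inner[OF emb n _ that]) (rule deg2)
  have Nq: "N (\<phi> VQ) = {\<phi> VP, \<phi> VR, z}"
  proof (rule card_seteq[symmetric])
    show "{\<phi> VP, \<phi> VR, z} \<subseteq> N (\<phi> VQ)"
      using embedsD(2)[OF emb, of VQ] z by (simp add: nbhd_HJ)
    have "card {\<phi> VP, \<phi> VR, z} = 3" using z(2) eq[of VP VR] by auto
    then show "card (N (\<phi> VQ)) \<le> card {\<phi> VP, \<phi> VR, z}" using card_N_le by simp
  qed simp
  have zout: "z \<noteq> \<phi> a" if "a \<in> pverts (HJ n)" "a \<noteq> VT" for a
  proof
    assume za: "z = \<phi> a"
    have "a \<noteq> VQ" using z(1) za by auto
    have "\<phi> VQ \<in> N (\<phi> a)" using N_sym[OF z(1)] za by simp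
    then have "\<phi> VQ \<in> \<phi> ` nbhd (HJ n) a" using inner[OF that(1) \<open>a \<noteq> VQ\<close> that(2)] by simp
    then have "VQ \<in> nbhd (HJ n) a"
      using inj_on_image_mem_iff[OF embedsD(1)[OF emb], of VQ "nbhd (HJ n) a"] nbhd_subset(2)[OF n]
      by simp
    then have "a \<in> nbhd (HJ n) VQ" by (simp only: nbhd_sym(2))
    then show False using z(2) za by (auto simp: nbhd_HJ)
  qed
  have "z = \<phi> VT \<and> n \<le> 2"
  proof (rule ccontr)
    assume neg: "\<not> (z = \<phi> VT \<and> n \<le> 2)"
    \<comment> \<open>\<open>x2\<close> is the third neighbour of y_1, and \<open>c\<close> is a
      further neighbour of \<open>x2\<close>: in the next square, or in the other cap if
      \<open>n = 1\<close>. In the latter case the negated claim says that \<open>z\<close> is not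
      the image of \<open>VT\<close>, which keeps \<open>z\<close> apart from \<open>c\<close> and
      nonadjacent to \<open>x2\<close>.\<close>
    define x2 c where "x2 = (if n = 1 then VS else VX 2)" and "c = (if n = 1 then VT else VY 2)"
    have mem: "x2 \<in> pverts (HJ n)" "c \<in> pverts (HJ n)" using n by (auto simp: x2_def c_def)
    have Np: "N (\<phi> VP) = {\<phi> (VX 1), \<phi> VQ}" by (simp add: inner nbhd_HJ)
    have Nx: "N (\<phi> (VX 1)) = {\<phi> (VY 1), \<phi> (VY' 1), \<phi> VP}" "N (\<phi> (VX' 1)) = {\<phi> (VY 1), \<phi> (VY' 1), \<phi> VR}"
      using n by (simp_all add: inner nbhd_HJ)
    have Ny: "N (\<phi> (VY 1)) = {\<phi> (VX 1), \<phi> (VX' 1), \<phi> x2}"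
      using n by (simp add: inner nbhd_HJ x2_def numeral_2_eq_2)
    have Nx2: "N (\<phi> x2) = (if n = 1 then {\<phi> (VY 1), \<phi> VT} else {\<phi> (VY 2), \<phi> (VY' 2), \<phi> (VY 1)})"
      using n by (simp add: inner nbhd_HJ x2_def numeral_2_eq_2)
    have z_not: "z \<notin> N (\<phi> (VX 1))" "z \<notin> N (\<phi> (VX' 1))" "z \<notin> N (\<phi> x2)"
      using neg zout n unfolding Nx Nx2 by (auto split: if_splits)
    have cz: "\<phi> c \<noteq> z"
      using neg zout[of c] mem n by (cases "n = 1") (auto simp: c_def)
    have "\<phi> VQ \<notin> N (\<phi> c)"
    proof
      assume "\<phi> VQ \<in> N (\<phi> c)"
      then have "\<phi> c \<in> {\<phi> VP, \<phi> VR, z}" unfolding N_commute[of "\<phi> VQ"] Nq .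
      then show False using cz mem eq[of c VP] eq[of c VR] by (auto simp: c_def split: if_splits)
    qed
    moreover have "\<phi> c \<notin> N (\<phi> (VX 1))" "\<phi> c \<notin> N (\<phi> (VX' 1))"
      using n mem unfolding Nx by (auto simp: eq c_def)
    moreover have "\<phi> c \<in> N (\<phi> x2)" unfolding Nx2 by (simp add: c_def)
    moreover have "distinct [\<phi> VQ, \<phi> (VX 1), \<phi> (VX' 1), \<phi> x2]"
      using n mem by (auto simp: eq x2_def)
    ultimately show False
      using cap_obstruction[OF Np Ny, of z "\<phi> c"] z_not cz N_sym[OF z(1)]
      by (simp only: N_commute[of _ z] N_commute[of _ "\<phi> c"]) simp
  qed
  then show "z = \<phi> VT" "n \<le> 2" by simp_all
qed

text \<open>The image is closed under taking neighbours, so connectedness makes it all of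
  \<open>V\<close>.\<close>

lemma embedding_bij:
  assumes emb: "embeds G \<phi>" and "pverts G \<noteq> {}"
    and nbhd: "\<And>a. a \<in> pverts G \<Longrightarrow> nbhd G a \<subseteq> pverts G"
      "\<And>a. a \<in> pverts G \<Longrightarrow> nbhd G a \<noteq> {}"
      "\<And>a. a \<in> pverts G \<Longrightarrow> N (\<phi> a) = \<phi> ` nbhd G a"
  shows "bij_betw \<phi> (pverts G) V"
proof -
  have "\<phi> ` pverts G = V"
  proof (rule connected)
    show "\<phi> ` pverts G \<subseteq> V"
    proof (rule image_subsetI)
      fix a assume "a \<in> pverts G"
      then obtain b where "\<phi> b \<in> N (\<phi> a)" using nbhd(2,3) by blast
      then show "\<phi> a \<in> V" by (rule N_nonempty_in_V)
    qed
    show "\<phi> ` pverts G \<noteq> {}" using assms(2) by simp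
    fix w assume "w \<in> \<phi> ` pverts G"
    then obtain a where a: "a \<in> pverts G" "w = \<phi> a" by blast
    show "N w \<subseteq> \<phi> ` pverts G"
      unfolding a(2) nbhd(3)[OF a(1)] by (rule image_mono[OF nbhd(1)[OF a(1)]])
  qed
  then show ?thesis using embedsD(1)[OF emb] by (simp add: bij_betw_def)
qed

text \<open>Once the copy is found, the open question is whether the two cap middles are adjacent: a
  third neighbour of one can only be the other, by \<open>HJ_cap_third_neighbour\<close> and its
  reversal.\<close>

theorem HJ_classification:
  assumes "x \<noteq> x'" "y \<noteq> y'" "{y, y'} \<subseteq> N x" "{y, y'} \<subseteq> N x'"
  obtains n G \<phi> where "1 \<le> n" "G = HJ n \<or> G = HJ_plus n \<and> n \<le> 2"
    "bij_betw \<phi> (pverts G) V" "\<And>a. a \<in> pverts G \<Longrightarrow> N (\<phi> a) = \<phi> ` nbhd G a"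
proof -
  obtain n \<phi> where n: "1 \<le> n" and emb: "embeds (HJ n) \<phi>"
    and deg2: "\<And>a. a \<in> {VP, VR, VS, VU} \<Longrightarrow> card (N (\<phi> a)) = 2"
    using exists_HJ_embedding[OF assms] by blast
  note inner = HJ_inner[OF emb n]
  note cap = HJ_cap_third_neighbour[OF emb n]
  have rev_deg2: "card (N ((\<phi> \<circ> hj_rev n) a)) = 2" if "a \<in> {VP, VR, VS, VU}" for a
    using that by (auto intro!: deg2)
  have rev_cap: "w = \<phi> VQ" if "w \<in> N (\<phi> VT)" "w \<notin> {\<phi> VS, \<phi> VU}" for w
    using HJ_cap_third_neighbour(1)[OF HJ_rev[OF emb n] n rev_deg2, of w] that by simp
  have qt: "{\<phi> VP, \<phi> VR} \<subseteq> N (\<phi> VQ)" "{\<phi> VS, \<phi> VU} \<subseteq> N (\<phi> VT)"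
    using embedsD(2)[OF emb, of VQ] embedsD(2)[OF emb, of VT] by (simp_all add: nbhd_HJ)
  have nonempty: "nbhd (HJ n) a \<noteq> {}" if "a \<in> pverts (HJ n)" for a
    using that by (cases a) (auto simp: nbhd_HJ)
  show thesis
  proof (cases "\<phi> VT \<in> N (\<phi> VQ)")
    case True
    have "\<phi> VT \<notin> {\<phi> VP, \<phi> VR}" by (simp add: embeds_eq_iff[OF emb])
    then have "n \<le> 2" using cap(2)[OF deg2 True] by blast
    have tq: "\<phi> VQ \<in> N (\<phi> VT)" by (rule N_sym[OF True])
    have Q: "N (\<phi> VQ) = {\<phi> VP, \<phi> VR, \<phi> VT}" using qt(1) True cap(1)[OF deg2] by blast
    have T: "N (\<phi> VT) = {\<phi> VS, \<phi> VU, \<phi> VQ}" using qt(2) tq rev_cap by blast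
    have N: "N (\<phi> a) = \<phi> ` nbhd (HJ_plus n) a" if "a \<in> pverts (HJ_plus n)" for a
    proof (cases "a = VQ \<or> a = VT")
      case True
      then show ?thesis using Q T by (auto simp: nbhd_HJ_plus nbhd_HJ)
    next
      case False
      then show ?thesis using that inner[OF deg2, of a] by (simp add: nbhd_HJ_plus)
    qed
    have "embeds (HJ_plus n) \<phi>"
      unfolding embeds_def pverts_simps(3)
      using embedsD[OF emb] True tq by (auto simp: nbhd_HJ_plus)
    then have "bij_betw \<phi> (pverts (HJ_plus n)) V"
    proof (rule embedding_bij)
      show "nbhd (HJ_plus n) a \<subseteq> pverts (HJ_plus n)" for a
        using nbhd_subset(3)[OF n] by (simp only: pverts_simps(3))
      show "nbhd (HJ_plus n) a \<noteq> {}" if "a \<in> pverts (HJ_plus n)" for a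
        using nonempty[of a] that by (simp add: nbhd_HJ_plus)
    qed (use N in auto)
    then show thesis using that[OF n _ _ N] \<open>n \<le> 2\<close> by blast
  next
    case False
    have Q: "N (\<phi> VQ) = {\<phi> VP, \<phi> VR}" using qt(1) False cap(1)[OF deg2] by blast
    have "\<phi> VQ \<notin> N (\<phi> VT)" using False unfolding N_commute[of "\<phi> VQ"] .
    then have T: "N (\<phi> VT) = {\<phi> VS, \<phi> VU}" using qt(2) rev_cap by blast
    have N: "N (\<phi> a) = \<phi> ` nbhd (HJ n) a" if "a \<in> pverts (HJ n)" for a
    proof (cases "a = VQ \<or> a = VT")
      case True
      then show ?thesis using Q T by (auto simp: nbhd_HJ)
    next
      case False
      then show ?thesis using that inner[OF deg2, of a] by simp
    qed
    have "bij_betw \<phi> (pverts (HJ n)) V"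
    proof (rule embedding_bij[OF emb])
      show "nbhd (HJ n) a \<subseteq> pverts (HJ n)" for a by (rule nbhd_subset(2)[OF n])
    qed (use N nonempty in auto)
    then show thesis using that[OF n _ _ N] by blast
  qed
qed

end

subsection \<open>From neighbourhoods to graphs\<close>

text \<open>The map runs from the model \<open>G\<close> to \<open>H\<close>, opposite to the
  conclusion, hence the initial swap.\<close>

lemma graph_isoI:
  assumes bij: "bij_betw \<phi> (pverts G) (pverts H)"
    and G: "parcs G \<subseteq> pverts G \<times> pverts G" and H: "parcs H \<subseteq> pverts H \<times> pverts H"
    and N: "\<And>a. a \<in> pverts G \<Longrightarrow> nbhd H (\<phi> a) = \<phi> ` nbhd G a"
  shows "graph_iso H G"
proof (rule digraph_iso_swap)
  have inj: "inj_on \<phi> (pverts G)" and img: "\<phi> ` pverts G = pverts H"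
    using bij by (auto simp: bij_betw_def)
  show wf: "wf_digraph (with_proj G)" using G by unfold_locales auto
  \<comment> \<open>Arcs are pairs, so the map acts on both components, and head and tail stay the
    projections as in \<open>with_proj H\<close>.\<close>
  define f where "f = \<lparr>iso_verts = \<phi>, iso_arcs = map_prod \<phi> \<phi>, iso_head = snd, iso_tail = fst\<rparr>"
  have "inj_on (map_prod \<phi> \<phi>) (parcs G)"
    by (rule inj_on_subset[OF map_prod_inj_on[OF inj inj] G])
  then have "pre_digraph.digraph_isomorphism (with_proj G) f"
    using wf inj by (simp add: pre_digraph.digraph_isomorphism_def f_def)
  moreover have "map_prod \<phi> \<phi> ` parcs G = parcs H"
  proof
    show "map_prod \<phi> \<phi> ` parcs G \<subseteq> parcs H"
    proof (rule image_subsetI)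
      fix e assume "e \<in> parcs G"
      then obtain a b where e: "e = (a, b)" "a \<in> pverts G" "b \<in> nbhd G a"
        using G by (cases e) (auto simp: nbhd_def)
      then have "\<phi> b \<in> nbhd H (\<phi> a)" using N[of a] by simp
      then show "map_prod \<phi> \<phi> e \<in> parcs H" by (simp add: nbhd_def e(1))
    qed
    show "parcs H \<subseteq> map_prod \<phi> \<phi> ` parcs G"
    proof (rule subrelI)
      fix u v assume uv: "(u, v) \<in> parcs H"
      then obtain a where a: "a \<in> pverts G" "u = \<phi> a" using H img by blast
      then have "v \<in> \<phi> ` nbhd G a" using uv N[of a] by (auto simp: nbhd_def)
      then show "(u, v) \<in> map_prod \<phi> \<phi> ` parcs G" using a(2) by (force simp: nbhd_def)
    qed
  qed
  then have "with_proj H = app_iso f (with_proj G)"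
    using img by (simp add: app_iso_def f_def with_proj_def)
  ultimately show "digraph_iso (with_proj G) (with_proj H)"
    unfolding digraph_iso_def by blast
qed

text \<open>The values of \<open>f\<close> listed along an enumeration form an eigenvector of the
  matrix. This is how the spectral hypothesis on matrices excludes eigenfunctions.\<close>

lemma nbhd_eigenvector_imp_adjacency_eigenvalue:
  assumes "finite (pverts H)" "v \<in> pverts H" "f v \<noteq> 0"
    and H: "\<And>v. nbhd H v \<subseteq> pverts H"
    and ev: "\<And>v. v \<in> pverts H \<Longrightarrow> (\<Sum>u\<in>nbhd H v. f u) = k * f v"
  shows "adjacency_eigenvalue H k"
proof -
  obtain vs where vs: "distinct vs" "set vs = pverts H"
    using finite_distinct_list[OF assms(1)] by blast
  define n where "n = length vs"
  define x where "x = Matrix.vec n (\<lambda>i. f (vs ! i))"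
  have "eigenvector (adjacency_matrix H vs) x k"
    unfolding eigenvector_def
  proof (intro conjI)
    show "x \<in> carrier_vec (dim_row (adjacency_matrix H vs))"
      by (simp add: x_def n_def adjacency_matrix_def)
    obtain i where i: "i < n" "vs ! i = v" using assms(2) vs by (metis in_set_conv_nth n_def)
    then have "x $ i \<noteq> 0" using assms(3) by (simp add: x_def)
    then show "x \<noteq> 0\<^sub>v (dim_row (adjacency_matrix H vs))"
      using i by (auto simp: adjacency_matrix_def n_def)
    show "adjacency_matrix H vs *\<^sub>v x = k \<cdot>\<^sub>v x"
    proof (rule eq_vecI)
      fix i assume "i < dim_vec (k \<cdot>\<^sub>v x)"
      then have i: "i < n" by (simp add: x_def)
      then have vi: "vs ! i \<in> pverts H" using nth_mem[of i vs] vs(2) by (simp add: n_def)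
      have "(adjacency_matrix H vs *\<^sub>v x) $ i
          = (\<Sum>j<n. (if (vs ! i, vs ! j) \<in> parcs H then 1 else 0) * f (vs ! j))"
        using i by (simp add: adjacency_matrix_def scalar_prod_def x_def n_def lessThan_atLeast0)
      also have "\<dots> = (\<Sum>j<n. if vs ! j \<in> nbhd H (vs ! i) then f (vs ! j) else 0)"
        by (rule sum.cong) (simp_all add: nbhd_def)
      also have "\<dots> = (\<Sum>u\<in>pverts H. if u \<in> nbhd H (vs ! i) then f u else 0)"
        using bij_betw_nth[OF vs(1) refl vs(2)[symmetric]] unfolding n_def
        by (rule sum.reindex_bij_betw)
      also have "\<dots> = (\<Sum>u\<in>nbhd H (vs ! i). f u)"
        using H[of "vs ! i"] assms(1) by (simp add: sum.inter_restrict[symmetric] Int_absorb1)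
      finally show "(adjacency_matrix H vs *\<^sub>v x) $ i = (k \<cdot>\<^sub>v x) $ i"
        using i ev[OF vi] by (simp add: x_def)
    qed (simp add: adjacency_matrix_def x_def n_def)
  qed
  then show ?thesis
    unfolding adjacency_eigenvalue_def eigenvalue_def using vs by blast
qed

text \<open>The infimum of a nonempty set of extended naturals is attained, so some cycle has
  exactly four arcs.\<close>

lemma girth_4_imp_square:
  assumes "girth H = 4"
  obtains x x' y y' where "x \<noteq> x'" "y \<noteq> y'" "(x, y) \<in> parcs H" "(y, x') \<in> parcs H"
    "(x', y') \<in> parcs H" "(y', x) \<in> parcs H"
proof -
  define L where "L = {enat (length p) |p. pre_digraph.cycle (with_proj H) p \<and> 3 \<le> length p}"
  have Inf: "Inf L = 4" using assms by (simp add: girth_def L_def)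
  \<comment> \<open>The infimum of the empty set is infinity.\<close>
  then have "L \<noteq> {}" by (auto simp: top_enat_def)
  then have "4 \<in> L" using Inf by (metis Inf_enat_def LeastI_ex ex_in_conv)
  then obtain p where p: "pre_digraph.cycle (with_proj H) p" "length p = 4"
    unfolding L_def by (auto simp: numeral_eq_enat)
  then obtain e1 e2 e3 e4 where "p = [e1, e2, e3, e4]"
    by (auto simp: numeral_eq_Suc length_Suc_conv)
  moreover obtain a1 b1 a2 b2 a3 b3 a4 b4
    where "e1 = (a1, b1)" "e2 = (a2, b2)" "e3 = (a3, b3)" "e4 = (a4, b4)"
    by (metis surj_pair)
  ultimately show thesis
    using p(1)
    unfolding pre_digraph.cycle_def pre_digraph.awalk_def cas_with_proj_eq awalk_verts_with_proj_eq
    by (intro that[of a1 a3 a2 a4]) auto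
qed

text \<open>Connectedness is reachability in the symmetric closure, whose arcs are arcs of
  \<open>H\<close> by \<open>sym\<close>; a walk starting in \<open>W\<close> therefore never leaves
  it.\<close>

lemma connected_closed_eq:
  assumes conn: "Digraph_Component.connected (with_proj H)" and "W \<subseteq> pverts H" "W \<noteq> {}"
    and sym: "\<And>u v. (u, v) \<in> parcs H \<Longrightarrow> (v, u) \<in> parcs H"
    and closed: "\<And>w. w \<in> W \<Longrightarrow> nbhd H w \<subseteq> W"
  shows "W = pverts H"
proof
  show "pverts H \<subseteq> W"
  proof
    fix v assume v: "v \<in> pverts H"
    obtain w where w: "w \<in> W" using assms(3) by blast
    let ?S = "mk_symmetric (with_proj H)"
    have "w \<rightarrow>\<^sup>*\<^bsub>with_proj ?S\<^esub> v"
      using conn v w assms(2) unfolding connected_def strongly_connected_def by auto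
    then have "(w, v) \<in> rtrancl_on (pverts H) (parcs ?S)"
      by (simp add: reachable_def)
    then show "v \<in> W"
    proof (induct rule: rtrancl_on_induct)
      case (step b c)
      then have "(b, c) \<in> parcs H" using sym[of c b] by (auto simp: parcs_mk_symmetric)
      then show ?case using closed[of b] step by (auto simp: nbhd_def)
    qed (rule w)
  qed
qed fact

section \<open>The classification for graphs given by arcs\<close>

theorem theorem2p8:
  fixes H :: "'a pair_pre_digraph"
  assumes "pair_graph H"
    and "Digraph_Component.connected (with_proj H)"
    and "bipartite H"
    and "max_degree H \<le> 3"
    and "min_degree H = 2"
    and "girth H = 4"
    and "\<not> (\<exists>k \<in> {-1<..<1}. adjacency_eigenvalue H k)"
  shows "graph_iso H (HJ_plus 1) \<or> graph_iso H (HJ_plus 2) \<or> (\<exists>n\<ge>1. graph_iso H (HJ n))"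
proof -
  interpret H: pair_graph H by fact
  have fin: "finite (pverts H)" by (rule H.pair_finite_verts)
  have sub: "nbhd H v \<subseteq> pverts H" for v using H.in_arcsD2 by (auto simp: nbhd_def)
  have sym: "(v, u) \<in> parcs H" if "(u, v) \<in> parcs H" for u v
    using symD[OF _ that] H.pair_sym_arcs by (simp add: symmetric_def)
  obtain x x' y y' where sq: "x \<noteq> x'" "y \<noteq> y'" "(x, y) \<in> parcs H" "(y, x') \<in> parcs H"
      "(x', y') \<in> parcs H" "(y', x) \<in> parcs H"
    by (rule girth_4_imp_square[OF \<open>girth H = 4\<close>])
  \<comment> \<open>Nonemptiness gives \<open>Max\<close> and \<open>Min\<close> of the degrees
    their meaning.\<close>
  then have ne: "pverts H \<noteq> {}" using H.in_arcsD1 by blast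
  have deg: "out_degree (with_proj H) v = card (nbhd H v)" for v
  proof -
    have "out_arcs (with_proj H) v = Pair v ` nbhd H v" by (auto simp: out_arcs_def nbhd_def)
    then show ?thesis by (simp add: out_degree_def card_image inj_on_def)
  qed
  let ?D = "(\<lambda>v. card (nbhd H v)) ` pverts H"
  have D: "finite ?D" "?D \<noteq> {}" using fin ne by simp_all
  have Max: "Max ?D \<le> 3" and Min: "Min ?D = 2"
    using \<open>max_degree H \<le> 3\<close> \<open>min_degree H = 2\<close> by (simp_all add: max_degree_def min_degree_def deg)
  interpret N: finite_nbhd "pverts H" "nbhd H"
  proof
    show "v \<in> nbhd H u" if "u \<in> nbhd H v" for u v using that sym[of v u] by (simp add: nbhd_def)
  qed (rule fin sub)+
  interpret N: subcubic_gap_graph "pverts H" "nbhd H"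
  proof unfold_locales
    fix f :: "'a \<Rightarrow> real"
    show "(\<Sum>v\<in>pverts H. (f v)\<^sup>2) \<le> (\<Sum>v\<in>pverts H. (N.adj f v)\<^sup>2)"
    proof (rule N.no_small_eigenvalue_imp_form_ge, rule ccontr)
      fix k g v
      assume *: "\<bar>k\<bar> < 1" "\<And>v. v \<in> pverts H \<Longrightarrow> N.adj g v = k * g v" "v \<in> pverts H" "g v \<noteq> 0"
      have "adjacency_eigenvalue H k"
        by (rule nbhd_eigenvector_imp_adjacency_eigenvalue[where f = g, OF fin *(3,4) sub])
          (use *(2) in \<open>simp add: N.adj_def\<close>)
      then show False using *(1) assms(7) by (auto simp: abs_less_iff)
    qed
  next
    fix v show "card (nbhd H v) \<le> 3"
    proof (cases "v \<in> pverts H")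
      case True then show ?thesis using Max D by auto
    next
      case False
      \<comment> \<open>The maximum ranges over vertices; any other point has no neighbours.\<close>
      then have "nbhd H v = {}" using H.in_arcsD1 by (auto simp: nbhd_def)
      then show ?thesis by simp
    qed
  next
    fix v assume "v \<in> pverts H"
    then have "Min ?D \<le> card (nbhd H v)" using D by (intro Min_le) auto
    then show "2 \<le> card (nbhd H v)" using Min by simp
  next
    fix u v assume "v \<in> nbhd H u"
    obtain A B where disj: "A \<inter> B = {}"
        and arcs: "\<forall>(u, v) \<in> parcs H. (u \<in> A \<and> v \<in> B) \<or> (u \<in> B \<and> v \<in> A)"
      using \<open>bipartite H\<close> unfolding bipartite_def by blast
    then have AB: "u \<in> A \<and> v \<in> B \<or> u \<in> B \<and> v \<in> A" if "(u, v) \<in> parcs H" for u v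
      using that by fast
    \<comment> \<open>Three mutually adjacent vertices cannot be distributed over two disjoint
      classes.\<close>
    have "False" if "(u, v) \<in> parcs H" "(u, w) \<in> parcs H" "(v, w) \<in> parcs H" for w
      using AB[OF that(1)] AB[OF that(2)] AB[OF that(3)] disj by blast
    then show "nbhd H u \<inter> nbhd H v = {}" using \<open>v \<in> nbhd H u\<close> by (auto simp: nbhd_def)
  next
    fix W assume W: "W \<subseteq> pverts H" "W \<noteq> {}" "\<And>w. w \<in> W \<Longrightarrow> nbhd H w \<subseteq> W"
    show "W = pverts H"
      by (rule connected_closed_eq[OF assms(2) W(1,2)]) (erule sym, erule W(3))
  next
    have "2 \<in> ?D" using Min_in[OF D] Min by simp
    then show "\<exists>v\<in>pverts H. card (nbhd H v) \<noteq> 3" by force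
  qed
  obtain n G \<phi> where n: "1 \<le> n" and G: "G = HJ n \<or> G = HJ_plus n \<and> n \<le> 2"
    and \<phi>: "bij_betw \<phi> (pverts G) (pverts H)" "\<And>a. a \<in> pverts G \<Longrightarrow> nbhd H (\<phi> a) = \<phi> ` nbhd G a"
  proof (rule N.HJ_classification[OF sq(1,2)])
    show "{y, y'} \<subseteq> nbhd H x" "{y, y'} \<subseteq> nbhd H x'"
      using sq sym[OF sq(4)] sym[OF sq(6)] by (auto simp: nbhd_def)
  qed blast
  have "parcs G \<subseteq> pverts G \<times> pverts G"
  proof (rule subrelI)
    fix a b assume ab: "(a, b) \<in> parcs G"
    then have "(b, a) \<in> parcs G" using G by (auto simp: parcs_eq_symcl mem_symcl)
    then have "b \<in> nbhd G a" "a \<in> nbhd G b" using ab by (simp_all add: nbhd_def)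
    then show "(a, b) \<in> pverts G \<times> pverts G"
      using G nbhd_subset(2,3)[OF n, of a] nbhd_subset(2,3)[OF n, of b] by (auto simp del: pverts_simps(2))
  qed
  moreover have "parcs H \<subseteq> pverts H \<times> pverts H"
    using H.in_arcsD1 H.in_arcsD2 by auto
  ultimately have "graph_iso H G" using \<phi> by (intro graph_isoI)
  moreover have "n = 1 \<or> n = 2" if "n \<le> 2" using n that by linarith
  ultimately show ?thesis using G n by blast
qed

end
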